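(* A discrete-time filter that gives an explicit first order numerical integrator for the continuous-time filter $$\dot{\hat R}=\hat R\hat\Omega^\times,\qquad m\dot\omega=-m\hat\Omega\times\omega+\Phi'\big(\mathcal U^0(\hat R,U^m)\big)S_L(\hat R)-D\omega,\qquad \hat\Omega=\Omega^m-\omega$$ (with $S_L(\hat R)=\mathrm{vex}(L^T\hat R-\hat R^TL)$, $L=EW(U^m)^T$) is given by $$\hat R_{i+1}=\hat R_i\exp\big(h(\Omega^m_{i+1}-\omega_{i+1})^\times\big),$$ $$\omega_{i+1}=\big(mI_{3\times3}+hD\big)^{-1}\Big\{\exp\big(-h\hat\Omega_i^\times\big)m\omega_i+h\Phi'\big(\mathcal U^0(\hat R_i,U^m_i)\big)S_{L_i}(\hat R_i)\Big\},$$ $$\hat\Omega_i=\Omega^m_i-\omega_i,$$ where $S_{L_i}(\hat R_i)=\mathrm{vex}(L_i^T\hat R_i-\hat R_i^TL_i)$, $L_i=E_iW_i(U^m_i)^T$, and $(\hat R_0,\hat\Omega_0)\in SO(3)\times\mathbb R^3$ are initial estimated states.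
   Context: $a^\times$ is the skew-symmetric matrix with $a^\times c=a\times c$; $\mathrm{vex}$ is the inverse of $a\mapsto a^\times$; $\langle A_1,A_2\rangle=\mathrm{trace}(A_1^TA_2)$. $E$ (rank 3, $3\times n$) is the matrix of known inertial vectors, $U^m$ the matrix of the same vectors measured in the body frame (when exactly two vectors are measured, their cross product is used as a third column), $W$ a positive definite weight matrix chosen such that $EWE^T=U_E\,\mathrm{diag}(d_1,d_2,d_3)\,U_E^T$ with $d_1,d_2,d_3>0$ and $U_E$ the orthogonal matrix of left singular vectors of $E$, $\Omega^m$ the measured angular velocity; $\hat R\in SO(3)$ and $\hat\Omega\in\mathbb R^3$ are the estimated attitude and angular velocity. $m>0$ is a scalar, $D\in\mathbb R^{3\times3}$ is positive definite. $\mathcal U^0(\hat R,U^m)=\frac12\langle E-\hat RU^m,(E-\hat RU^m)W\rangle$. $\Phi:[0,\infty)\to[0,\infty)$ is a $C^2$ function with $\Phi(0)=0$ and $\Phi'(x)>0$ for all $x\in[0,\infty)$; furthermore $\Phi'(\cdot)\le\alpha(\cdot)$ where $\alpha(\cdot)$ is a Class-$\mathcal K$ function. The interval $[t_0,T]$ is divided into $N$ subintervals $[t_i,t_{i+1}]$ of length $h$; a subscript $i$ denotes the value at $t_i$ (for estimates: the discrete approximation to the exact continuous-time filter solution at $t_i$).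
   Formalization: E, W, U^m and Ω^m are assumed Lipschitz in time on [t_0,T], since first order accuracy fails for merely continuous data; the contradictory conditions Φ'(0)>0 and Φ'≤α with α of Class K are replaced by Φ'>0 on (0,∞) with no Class-K bound. *)

theory Defs
  imports "HOL-Analysis.Analysis"
begin

section \<open>Matrices\<close>

definition hat :: "real^3 \<Rightarrow> real^3^3"
  where "hat a = matrix (cross3 a)"

text \<open>Only meaningful on skew-symmetric matrices, which form the range of \<open>hat\<close>.\<close>

definition vex :: "real^3^3 \<Rightarrow> real^3"
  where "vex = inv hat"

text \<open>The library's \<open>exp\<close> is not available on square matrices: the type has no
  normed-algebra instance (and its \<open>*\<close> is the componentwise product).\<close>

definition mexp :: "real^'n^'n \<Rightarrow> real^'n^'n"
  where "mexp A = (\<Sum>k. (1 / fact k) *\<^sub>R (((**) A ^^ k) (mat 1)))"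

definition trace_inner :: "real^'n^'m \<Rightarrow> real^'n^'m \<Rightarrow> real"
  where "trace_inner A B = trace (transpose A ** B)"

definition pos_def :: "real^'n^'n \<Rightarrow> bool"
  where "pos_def A \<longleftrightarrow> transpose A = A \<and> (\<forall>x. x \<noteq> 0 \<longrightarrow> 0 < x \<bullet> (A *v x))"

definition diag :: "real^'n \<Rightarrow> real^'n^'n"
  where "diag d = (\<chi> i j. if i = j then d $ i else 0)"

definition left_singular_vector :: "real^'n^'m \<Rightarrow> real^'m \<Rightarrow> bool"
  where "left_singular_vector A u \<longleftrightarrow>
    norm u = 1 \<and>
    (\<exists>\<sigma> v. 0 \<le> \<sigma> \<and> norm v = 1 \<and> A *v v = \<sigma> *\<^sub>R u \<and> transpose A *v u = \<sigma> *\<^sub>R v)"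


section \<open>Attitude measurements\<close>

text \<open>The columns of \<open>E\<close> are the known inertial vectors; full rank forces at least three of
  them.  If only two vectors are measured, \<open>'n\<close> has three elements and the third column
  of \<open>E\<close> (and of the matrix \<open>Um\<close> of measured body vectors) is the cross product of the
  other two.\<close>

definition admissible_weight :: "real^'n^3 \<Rightarrow> real^'n^'n \<Rightarrow> bool"
  where "admissible_weight E W \<longleftrightarrow> pos_def W \<and>
    (\<exists>U d. orthogonal_matrix U \<and> (\<forall>i. left_singular_vector E (column i U)) \<and>
      (\<forall>i. 0 < d $ i) \<and> E ** W ** transpose E = U ** diag d ** transpose U)"

definition wahba_cost :: "real^'n^3 \<Rightarrow> real^'n^'n \<Rightarrow> real^'n^3 \<Rightarrow> real^3^3 \<Rightarrow> real"
  where "wahba_cost E W Um R = 1/2 * trace_inner (E - R ** Um) ((E - R ** Um) ** W)"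

definition L_matrix :: "real^'n^3 \<Rightarrow> real^'n^'n \<Rightarrow> real^'n^3 \<Rightarrow> real^3^3"
  where "L_matrix E W Um = E ** W ** transpose Um"

definition S_vec :: "real^3^3 \<Rightarrow> real^3^3 \<Rightarrow> real^3"
  where "S_vec L R = vex (transpose L ** R - transpose R ** L)"

text \<open>\<open>\<Phi>'\<close> is the derivative of \<open>\<Phi>\<close>; derivatives at \<open>0\<close> are one-sided.

  The source asks for \<open>\<Phi>' > 0\<close> on all of \<open>[0, \<infinity>)\<close> and also for \<open>\<Phi>' \<le> \<alpha>\<close> with \<open>\<alpha>\<close> of
  Class K.  These are contradictory, since \<open>\<alpha> 0 = 0\<close>.  Positivity is therefore only
  required on \<open>(0, \<infinity>)\<close> and the bound by \<open>\<alpha>\<close> is not imposed, so that the condition follows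
  from either of the two requirements repaired at the expense of the other.\<close>

definition potential_shape :: "(real \<Rightarrow> real) \<Rightarrow> (real \<Rightarrow> real) \<Rightarrow> bool"
  where "potential_shape \<Phi> \<Phi>' \<longleftrightarrow>
    (\<forall>x\<ge>0. 0 \<le> \<Phi> x) \<and> \<Phi> 0 = 0 \<and>
    (\<forall>x\<ge>0. (\<Phi> has_real_derivative \<Phi>' x) (at x within {0..})) \<and>
    (\<exists>\<Phi>''. (\<forall>x\<ge>0. (\<Phi>' has_real_derivative \<Phi>'' x) (at x within {0..})) \<and>
      continuous_on {0..} \<Phi>'') \<and>
    (\<forall>x>0. 0 < \<Phi>' x)"


section \<open>One-step methods\<close>

definition solves_ode_on ::
  "(real \<Rightarrow> 'a \<Rightarrow> 'a::real_normed_vector) \<Rightarrow> real \<Rightarrow> real \<Rightarrow> (real \<Rightarrow> 'a) \<Rightarrow> bool"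
  where "solves_ode_on f t\<^sub>0 T y \<longleftrightarrow>
    (\<forall>t\<in>{t\<^sub>0..T}. (y has_vector_derivative f t (y t)) (at t within {t\<^sub>0..T}))"

text \<open>An explicit one-step method is a map \<open>\<Psi>\<close> such that \<open>\<Psi> h t\<close> takes the approximation at
  time \<open>t\<close> to the approximation at time \<open>t + h\<close>.\<close>

primrec one_step_iter :: "(real \<Rightarrow> real \<Rightarrow> 'a \<Rightarrow> 'a) \<Rightarrow> real \<Rightarrow> real \<Rightarrow> 'a \<Rightarrow> nat \<Rightarrow> 'a"
  where
    "one_step_iter \<Psi> h t\<^sub>0 y\<^sub>0 0 = y\<^sub>0"
  | "one_step_iter \<Psi> h t\<^sub>0 y\<^sub>0 (Suc i) = \<Psi> h (t\<^sub>0 + real i * h) (one_step_iter \<Psi> h t\<^sub>0 y\<^sub>0 i)"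

text \<open>Order in the usual sense: the local error along the exact solution is \<open>O(h ^ (p + 1))\<close>
  and the global error on the grid with \<open>N\<close> equal subintervals is \<open>O(h ^ p)\<close>.\<close>

definition consistent_of_order ::
  "nat \<Rightarrow> (real \<Rightarrow> real \<Rightarrow> 'a \<Rightarrow> 'a::real_normed_vector) \<Rightarrow> real \<Rightarrow> real \<Rightarrow> (real \<Rightarrow> 'a) \<Rightarrow> bool"
  where "consistent_of_order p \<Psi> t\<^sub>0 T y \<longleftrightarrow>
    (\<exists>C. \<forall>t h. t\<^sub>0 \<le> t \<longrightarrow> 0 < h \<longrightarrow> t + h \<le> T \<longrightarrow>
      norm (\<Psi> h t (y t) - y (t + h)) \<le> C * h ^ (p + 1))"

definition convergent_of_order ::
  "nat \<Rightarrow> (real \<Rightarrow> real \<Rightarrow> 'a \<Rightarrow> 'a::real_normed_vector) \<Rightarrow> real \<Rightarrow> real \<Rightarrow> (real \<Rightarrow> 'a) \<Rightarrow> bool"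
  where "convergent_of_order p \<Psi> t\<^sub>0 T y \<longleftrightarrow>
    (\<exists>C. \<forall>N\<ge>1. \<forall>h. h = (T - t\<^sub>0) / real N \<longrightarrow>
      (\<forall>i\<le>N. norm (one_step_iter \<Psi> h t\<^sub>0 (y t\<^sub>0) i - y (t\<^sub>0 + real i * h)) \<le> C * h ^ p))"

definition integrator_of_order ::
  "nat \<Rightarrow> (real \<Rightarrow> real \<Rightarrow> 'a \<Rightarrow> 'a) \<Rightarrow> (real \<Rightarrow> 'a \<Rightarrow> 'a::real_normed_vector) \<Rightarrow>
    real \<Rightarrow> real \<Rightarrow> 'a \<Rightarrow> bool"
  where "integrator_of_order p \<Psi> f t\<^sub>0 T y\<^sub>0 \<longleftrightarrow>
    (\<forall>y. solves_ode_on f t\<^sub>0 T y \<longrightarrow> y t\<^sub>0 = y\<^sub>0 \<longrightarrow>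
      consistent_of_order p \<Psi> t\<^sub>0 T y \<and> convergent_of_order p \<Psi> t\<^sub>0 T y)"


section \<open>The filters\<close>

text \<open>The state is the pair of the attitude estimate and \<open>\<omega>\<close>; the angular velocity estimate is
  \<open>\<Omega> = \<Omega>m t - \<omega>\<close>, so its error has the same norm as that of \<open>\<omega>\<close>.\<close>

definition filter_field ::
  "real \<Rightarrow> real^3^3 \<Rightarrow> (real \<Rightarrow> real) \<Rightarrow> (real \<Rightarrow> real^'n^3) \<Rightarrow> (real \<Rightarrow> real^'n^'n) \<Rightarrow>
    (real \<Rightarrow> real^'n^3) \<Rightarrow> (real \<Rightarrow> real^3) \<Rightarrow> real \<Rightarrow> (real^3^3) \<times> (real^3) \<Rightarrow> (real^3^3) \<times> (real^3)"
  where "filter_field m D \<Phi>' E W Um \<Omega>m t = (\<lambda>(R, \<omega>).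
    let \<Omega> = \<Omega>m t - \<omega>;
        L = L_matrix (E t) (W t) (Um t)
    in (R ** hat \<Omega>,
        (1 / m) *\<^sub>R (- (m *\<^sub>R cross3 \<Omega> \<omega>)
          + \<Phi>' (wahba_cost (E t) (W t) (Um t) R) *\<^sub>R S_vec L R - D *v \<omega>)))"

definition filter_step ::
  "real \<Rightarrow> real^3^3 \<Rightarrow> (real \<Rightarrow> real) \<Rightarrow> (real \<Rightarrow> real^'n^3) \<Rightarrow> (real \<Rightarrow> real^'n^'n) \<Rightarrow>
    (real \<Rightarrow> real^'n^3) \<Rightarrow> (real \<Rightarrow> real^3) \<Rightarrow>
    real \<Rightarrow> real \<Rightarrow> (real^3^3) \<times> (real^3) \<Rightarrow> (real^3^3) \<times> (real^3)"
  where "filter_step m D \<Phi>' E W Um \<Omega>m h t = (\<lambda>(R, \<omega>).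
    let \<Omega> = \<Omega>m t - \<omega>;
        L = L_matrix (E t) (W t) (Um t);
        \<omega>_next = matrix_inv (m *\<^sub>R mat 1 + h *\<^sub>R D) *v
          (mexp (- (h *\<^sub>R hat \<Omega>)) *v (m *\<^sub>R \<omega>)
            + (h * \<Phi>' (wahba_cost (E t) (W t) (Um t) R)) *\<^sub>R S_vec L R);
        R_next = R ** mexp (h *\<^sub>R hat (\<Omega>m (t + h) - \<omega>_next))
    in (R_next, \<omega>_next))"

end

theory Submission
  imports Defs
begin

text \<open>Along any bounded set of states the filter step agrees with an explicit Euler step up to
  \<open>O(h\<^sup>2)\<close>: Rodrigues' formula gives \<open>exp (h a\<^sup>\<times>) = I + h a\<^sup>\<times> + O(h\<^sup>2)\<close>, and since
  \<open>\<bar>(m I + h D) x\<bar> \<ge> m \<bar>x\<bar>\<close> for positive definite \<open>D\<close>, the linear solve for \<open>\<omega>\<^sub>i\<^sub>+\<^sub>1\<close> is \<open>O(h\<^sup>2)\<close>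
  accurate as well. The vector field is Lipschitz on bounded sets, because the Wahba cost is
  nonnegative and bounded there and \<open>\<Phi>'\<close> is \<open>C\<^sup>1\<close>. The iterates stay bounded uniformly in \<open>h\<close>:
  the attitudes are rotations, and \<open>exp\<close> of a skew matrix preserves the norm, so \<open>\<bar>\<omega>\<bar>\<close> grows by at
  most \<open>O(h)\<close> per step. A discrete Gronwall argument then turns the local error into the
  global one.\<close>

section \<open>Rodrigues' formula\<close>

lemma bounded_bilinear_matrix_mult: "bounded_bilinear ((**) :: real^'n^'m \<Rightarrow> real^'k^'n \<Rightarrow> real^'k^'m)"
proof -
  have "linear ((**) A)" for A :: "real^'n^'m"
    by (rule linearI) (simp_all add: matrix_add_ldistrib matrix_scalar_ac scalar_matrix_assoc)
  moreover have "linear (\<lambda>A. A ** B)" for B :: "real^'k^'n"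
    by (rule linearI)
      (simp_all add: matrix_matrix_mult_def vec_eq_iff sum.distrib distrib_right scalar_matrix_assoc
        sum_distrib_left mult.assoc)
  \<comment> \<open>In finite dimension bilinearity already implies boundedness. The constant
    obtained this way takes the place of a submultiplicative matrix norm in all later
    estimates.\<close>
  ultimately show ?thesis
    unfolding bilinear_conv_bounded_bilinear[symmetric] bilinear_def by blast
qed

lemma bounded_bilinear_matrix_vector_mult:
  "bounded_bilinear ((*v) :: real^'n^'m \<Rightarrow> real^'n \<Rightarrow> real^'m)"
proof -
  have "linear (\<lambda>A. A *v x)" for x :: "real^'n"
    by (rule linearI) (simp_all add: matrix_vector_mult_add_rdistrib flip: scaleR_matrix_vector_assoc)
  then show ?thesis
    unfolding bilinear_conv_bounded_bilinear[symmetric] bilinear_def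
    using matrix_vector_mul_linear by blast
qed

lemma hat_mult_vec [simp]: "hat a *v x = cross3 a x"
proof -
  have "Vector_Spaces.linear (*s) (*s) (cross3 a)"
    using bilinear_cross by (simp add: bilinear_def linear_def scalar_mult_eq_scaleR linear_matrix_vector_mul_eq)
  then show ?thesis
    unfolding hat_def by (rule matrix_works)
qed

lemma hat_components:
  "hat a = vector [vector [0, - a$3, a$2], vector [a$3, 0, - a$1], vector [- a$2, a$1, 0]]"
  unfolding matrix_eq hat_mult_vec by (simp add: matrix_vector_mult_def cross3_simps forall_3)

lemma linear_hat: "linear hat"
  by (rule linearI) (simp_all add: hat_components vec_eq_iff forall_3)

text \<open>As an \<open>inv\<close>, \<open>vex\<close> has a determined value only on the range of
  \<open>hat\<close>, where injectivity of \<open>hat\<close> fixes it. The point is to replace it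
  there by a map that is visibly linear in the entries.\<close>

lemma vex_skew:
  assumes "transpose A = - A"
  shows "vex A = vector [A$3$2, A$1$3, A$2$1]"
proof -
  have skew: "A$j$i = - (A$i$j)" for i j
    using arg_cong[OF assms, of "\<lambda>B. B $ i $ j"] by (simp add: transpose_def)
  have "A = hat (vector [A$3$2, A$1$3, A$2$1])"
    using skew[of 1 1] skew[of 2 2] skew[of 3 3] skew[of 1 2] skew[of 1 3] skew[of 2 3]
    by (simp add: hat_components vec_eq_iff forall_3)
  moreover have "inj hat"
    by (rule injI) (simp add: hat_components vec_eq_iff forall_3)
  ultimately show ?thesis
    unfolding vex_def by (metis inv_f_f)
qed

text \<open>Lagrange's formula for the triple product, applied to \<open>cross3 a x\<close>, which
  is orthogonal to \<open>a\<close>. It reduces every positive power of \<open>hat a\<close> to a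
  multiple of \<open>hat a\<close> or of its square.\<close>

lemma hat_cubed: "hat a ** (hat a ** hat a) = - (norm a)\<^sup>2 *\<^sub>R hat a"
proof -
  have "cross3 a (cross3 a (cross3 a x)) = - (norm a)\<^sup>2 *\<^sub>R cross3 a x" for x
    by (simp add: Lagrange[of a a "cross3 a x"] dot_cross_self power2_norm_eq_inner)
  then show ?thesis
    unfolding matrix_eq
    by (simp del: scaleR_minus_left flip: matrix_vector_mul_assoc scaleR_matrix_vector_assoc)
qed

text \<open>By \<open>hat_cubed\<close> the odd terms of the exponential series are multiples of
  \<open>A\<close> and the even ones, from the second power on, multiples of \<open>A ** A\<close>;
  their coefficients are those of the sine and cosine series.\<close>

lemma rodrigues:
  assumes "a \<noteq> 0"
  shows "mexp (hat a) = mat 1 + (sin (norm a) / norm a) *\<^sub>R hat a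
    + ((1 - cos (norm a)) / (norm a)\<^sup>2) *\<^sub>R (hat a ** hat a)"
proof -
  define \<theta> A where "\<theta> = norm a" and "A = hat a"
  have \<theta>: "\<theta> \<noteq> 0" using assms by (simp add: \<theta>_def)
  have cube: "A ** (A ** A) = - \<theta>\<^sup>2 *\<^sub>R A"
    by (simp add: A_def \<theta>_def hat_cubed)
  define B where "B k = (1 / fact k) *\<^sub>R (((**) A ^^ k) (mat 1))" for k :: nat
  \<comment> \<open>The termwise combination of the sine series divided by \<open>\<theta>\<close>
    and the cosine series divided by the square of \<open>\<theta>\<close>. One of the two
    coefficients vanishes for each \<open>k\<close>, so the parity of \<open>k\<close> needs no case
    distinction.\<close>
  define c where "c k = (sin_coeff k *\<^sub>R \<theta> ^ k / \<theta>) *\<^sub>R A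
    - (cos_coeff k *\<^sub>R \<theta> ^ k / \<theta>\<^sup>2) *\<^sub>R (A ** A)" for k
  have BSuc: "B (Suc k) = (1 / real (Suc k)) *\<^sub>R (A ** B k)" for k
    by (simp add: B_def matrix_scalar_ac flip: scalar_matrix_assoc)
  have 1: "B (Suc k) = c (Suc k)" for k
  proof (induction k)
    case 0
    show ?case
      using \<theta> by (simp add: B_def c_def sin_coeff_def cos_coeff_def)
  next
    case (Suc k)
    have "A ** c (Suc k) = (sin_coeff (Suc k) *\<^sub>R \<theta> ^ Suc k / \<theta>) *\<^sub>R (A ** A)
      - (cos_coeff (Suc k) *\<^sub>R \<theta> ^ Suc k / \<theta>\<^sup>2) *\<^sub>R (A ** (A ** A))"
      unfolding c_def
      by (simp add: bounded_bilinear.diff_right[OF bounded_bilinear_matrix_mult]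
          bounded_bilinear.scaleR_right[OF bounded_bilinear_matrix_mult] del: power_Suc)
    then have "B (Suc (Suc k)) =
        (1 / real (Suc (Suc k)) * (sin_coeff (Suc k) *\<^sub>R \<theta> ^ Suc k / \<theta>)) *\<^sub>R (A ** A)
        + (1 / real (Suc (Suc k)) * (cos_coeff (Suc k) *\<^sub>R \<theta> ^ Suc k / \<theta>\<^sup>2 * \<theta>\<^sup>2)) *\<^sub>R A"
      unfolding BSuc[of "Suc k"] Suc cube by (simp add: scaleR_add_right del: power_Suc)
    also have "1 / real (Suc (Suc k)) * (sin_coeff (Suc k) *\<^sub>R \<theta> ^ Suc k / \<theta>)
        = - (cos_coeff (Suc (Suc k)) *\<^sub>R \<theta> ^ Suc (Suc k) / \<theta>\<^sup>2)"
      unfolding cos_coeff_Suc[of "Suc k"] using \<theta> by (simp add: power2_eq_square del: of_nat_Suc)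
    also have "1 / real (Suc (Suc k)) * (cos_coeff (Suc k) *\<^sub>R \<theta> ^ Suc k / \<theta>\<^sup>2 * \<theta>\<^sup>2)
        = sin_coeff (Suc (Suc k)) *\<^sub>R \<theta> ^ Suc (Suc k) / \<theta>"
      unfolding sin_coeff_Suc[of "Suc k"] using \<theta> by (simp add: power2_eq_square del: of_nat_Suc)
    finally show ?case
      by (simp add: c_def del: power_Suc)
  qed
  \<comment> \<open>The two series agree except at index 0: there \<open>B\<close> has the identity,
    whereas \<open>c\<close> has the constant term of the cosine, a negative multiple of
    \<open>A ** A\<close>. The added term corrects this.\<close>
  have "B = (\<lambda>k. c k + (if k = 0 then mat 1 + (1 / \<theta>\<^sup>2) *\<^sub>R (A ** A) else 0))"
  proof
    show "B k = c k + (if k = 0 then mat 1 + (1 / \<theta>\<^sup>2) *\<^sub>R (A ** A) else 0)" for k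
      using 1[of "k - 1"] by (cases k) (simp_all add: B_def c_def)
  qed
  moreover have "(\<lambda>k. if k = 0 then mat 1 + (1 / \<theta>\<^sup>2) *\<^sub>R (A ** A) else 0) sums
      (mat 1 + (1 / \<theta>\<^sup>2) *\<^sub>R (A ** A))"
    by (rule sums_single)
  moreover have "c sums ((sin \<theta> / \<theta>) *\<^sub>R A - (cos \<theta> / \<theta>\<^sup>2) *\<^sub>R (A ** A))"
    unfolding c_def
    by (intro sums_diff bounded_linear.sums[OF bounded_linear_scaleR_left] sums_divide
        sin_converges cos_converges)
  ultimately have "B sums ((sin \<theta> / \<theta>) *\<^sub>R A - (cos \<theta> / \<theta>\<^sup>2) *\<^sub>R (A ** A)
    + (mat 1 + (1 / \<theta>\<^sup>2) *\<^sub>R (A ** A)))"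
    by (simp only: sums_add)
  then have "mexp A = (sin \<theta> / \<theta>) *\<^sub>R A - (cos \<theta> / \<theta>\<^sup>2) *\<^sub>R (A ** A)
    + (mat 1 + (1 / \<theta>\<^sup>2) *\<^sub>R (A ** A))"
    unfolding mexp_def B_def by (simp add: sums_iff)
  then show ?thesis
    by (simp add: A_def \<theta>_def algebra_simps diff_divide_distrib)
qed

lemma mexp_zero [simp]: "mexp (0 :: real^'n^'n) = mat 1"
proof -
  have "(1 / fact k) *\<^sub>R (((**) (0 :: real^'n^'n) ^^ k) (mat 1)) = (if k = 0 then mat 1 else 0)" for k :: nat
    by (cases k) simp_all
  then have "mexp (0 :: real^'n^'n) = (\<Sum>k. if k = 0 then mat 1 else 0)"
    unfolding mexp_def by presburger
  also have "\<dots> = mat 1"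
    by (rule sums_unique[OF sums_single[of 0 "\<lambda>_. mat 1 :: real^'n^'n"], symmetric])
  finally show ?thesis .
qed

text \<open>With the two Rodrigues coefficients abbreviated to \<open>s\<close> and
  \<open>c\<close>, orthogonality and determinant 1 become polynomial identities in
  \<open>s\<close>, \<open>c\<close> and the entries of \<open>a\<close>. They follow from the
  single relation \<open>key\<close>. The case of the zero vector is separate since Rodrigues'
  formula divides by the norm.\<close>

lemma rotation_matrix_mexp_hat: "rotation_matrix (mexp (hat a))"
proof (cases "a = 0")
  case True
  then show ?thesis
    by (simp add: linear_0[OF linear_hat] rotation_matrix_def orthogonal_matrix_id)
next
  case False
  define s c where "s = sin (norm a) / norm a" and "c = (1 - cos (norm a)) / (norm a)\<^sup>2"
  define x y z where "x = a$1" and "y = a$2" and "z = a$3"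
  have n: "(norm a)\<^sup>2 = x\<^sup>2 + y\<^sup>2 + z\<^sup>2"
    unfolding power2_norm_eq_inner by (simp add: inner_vec_def sum_3 x_def y_def z_def power2_eq_square)
  have s: "s * norm a = sin (norm a)" and c: "c * (norm a)\<^sup>2 = 1 - cos (norm a)"
    using False by (simp_all add: s_def c_def)
  \<comment> \<open>The Pythagorean identity for sine and cosine, expressed by \<open>s\<close> and
    \<open>c\<close>; cancelling the squared norm of \<open>a\<close> then yields
    \<open>key\<close>.\<close>
  have "(s * norm a)\<^sup>2 + (1 - c * (norm a)\<^sup>2)\<^sup>2 = 1"
    unfolding s c by simp
  then have "(norm a)\<^sup>2 * (s\<^sup>2 + c\<^sup>2 * (norm a)\<^sup>2 - 2 * c) = 0"
    by (simp add: power2_eq_square algebra_simps)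
  then have key: "s\<^sup>2 + c\<^sup>2 * (x\<^sup>2 + y\<^sup>2 + z\<^sup>2) = 2 * c"
    using False n by auto
  have Q: "mexp (hat a) = vector [
      vector [1 - c*(y\<^sup>2+z\<^sup>2), c*x*y - s*z, c*x*z + s*y],
      vector [c*x*y + s*z, 1 - c*(x\<^sup>2+z\<^sup>2), c*y*z - s*x],
      vector [c*x*z - s*y, c*y*z + s*x, 1 - c*(x\<^sup>2+y\<^sup>2)]]"
    unfolding rodrigues[OF False] s_def[symmetric] c_def[symmetric]
    by (simp add: vec_eq_iff forall_3 hat_components matrix_matrix_mult_def sum_3 mat_def
        x_def y_def z_def power2_eq_square algebra_simps)
  have "transpose (mexp (hat a)) ** mexp (hat a) = mat 1"
    unfolding Q using key
    by (simp add: vec_eq_iff forall_3 matrix_matrix_mult_def sum_3 mat_def transpose_def)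
      (intro conjI; algebra)
  moreover have "det (mexp (hat a)) = 1"
    unfolding Q det_3 using key
    by simp algebra
  ultimately show ?thesis
    by (simp add: rotation_matrix_def orthogonal_matrix)
qed


section \<open>Expansion of one step\<close>

lemma norm_orthogonal_matrix_mult:
  fixes Q :: "real^'n^'n"
  assumes "orthogonal_matrix Q"
  shows "norm (Q *v x) = norm x"
  using assms orthogonal_transformation_matrix[of "(*v) Q"]
  by (simp add: orthogonal_transformation)

text \<open>The matrix norm is the Euclidean norm of the vector of row norms, and each row is a unit
  vector. Bounding it by the sum of the row norms is crude but yields the radius 3 for
  attitudes.\<close>

lemma norm_orthogonal_matrix_le:
  fixes Q :: "real^'n^'n"
  assumes "orthogonal_matrix Q"
  shows "norm Q \<le> real CARD('n)"
proof -
  have "norm (Q $ i) = 1" for i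
    using assms by (simp add: orthogonal_matrix_orthonormal_rows row_def vec_lambda_eta)
  then show ?thesis
    using L2_set_le_sum[of UNIV "\<lambda>i. norm (Q $ i)"] by (simp add: norm_vec_def)
qed

lemma norm_cross_le: "norm (cross3 x y) \<le> norm x * norm y"
proof -
  have "(norm (cross3 x y))\<^sup>2 \<le> (norm x * norm y)\<^sup>2"
    using norm_cross_dot[of x y] by (metis le_add_same_cancel1 zero_le_power2)
  then show ?thesis
    by (rule power2_le_imp_le) simp
qed

lemma bounded_linear_hat: "bounded_linear hat"
  using linear_hat by (simp add: linear_conv_bounded_linear)

text \<open>In Rodrigues' formula the coefficient of \<open>A\<close> differs from 1 by at most
  \<open>\<theta> / 2\<close> and that of \<open>A ** A\<close> is at most \<open>1 / 2\<close>,
  while \<open>A\<close> itself is of size \<open>\<theta>\<close>. Both bounds hold for every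
  angle, so \<open>a\<close> need not be small.\<close>

lemma mexp_hat_linearization:
  "\<exists>C\<ge>0. \<forall>a. norm (mexp (hat a) - mat 1 - hat a) \<le> C * (norm a)\<^sup>2"
proof -
  obtain H where H: "H \<ge> 0" "\<And>a. norm (hat a) \<le> norm a * H"
    using bounded_linear.nonneg_bounded[OF bounded_linear_hat] by blast
  obtain K where K: "K \<ge> 0" "\<And>A B. norm ((A :: real^3^3) ** (B :: real^3^3)) \<le> norm A * norm B * K"
    using bounded_bilinear.nonneg_bounded[OF bounded_bilinear_matrix_mult] by blast
  have "norm (mexp (hat a) - mat 1 - hat a) \<le> (H / 2 + H\<^sup>2 * K / 2) * (norm a)\<^sup>2" for a
  proof (cases "a = 0")
    case True
    then show ?thesis by (simp add: linear_0[OF linear_hat])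
  next
    case False
    define \<theta> A where "\<theta> = norm a" and "A = hat a"
    have \<theta>: "\<theta> > 0" using False by (simp add: \<theta>_def)
    \<comment> \<open>A quadratic remainder is enough here: dividing by \<open>\<theta>\<close>
      leaves one power, and the factor \<open>A\<close> supplies the second.\<close>
    have "\<bar>sin \<theta> - \<theta>\<bar> \<le> \<theta>\<^sup>2 / 2"
      using Maclaurin_sin_bound[of \<theta> 2] by (simp add: numeral_2_eq_2 sin_coeff_def)
    moreover have "sin \<theta> / \<theta> - 1 = (sin \<theta> - \<theta>) / \<theta>"
      using \<theta> by (simp add: field_simps)
    ultimately have s: "\<bar>sin \<theta> / \<theta> - 1\<bar> \<le> \<theta> / 2"
      using \<theta> by (simp add: field_simps power2_eq_square)
    have "1 - cos \<theta> = 2 * (sin (\<theta> / 2))\<^sup>2"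
      using cos_double_sin[of "\<theta> / 2"] by simp
    also have "\<dots> \<le> 2 * (\<theta> / 2)\<^sup>2"
      using abs_sin_x_le_abs_x[of "\<theta> / 2"] unfolding abs_le_square_iff by simp
    finally have c: "\<bar>(1 - cos \<theta>) / \<theta>\<^sup>2\<bar> \<le> 1 / 2"
      using \<theta> by (simp add: field_simps)
    have "mexp A - mat 1 - A = (sin \<theta> / \<theta> - 1) *\<^sub>R A + ((1 - cos \<theta>) / \<theta>\<^sup>2) *\<^sub>R (A ** A)"
      using rodrigues[OF False] by (simp add: A_def \<theta>_def algebra_simps)
    then have "norm (mexp A - mat 1 - A)
        \<le> \<bar>sin \<theta> / \<theta> - 1\<bar> * norm A + \<bar>(1 - cos \<theta>) / \<theta>\<^sup>2\<bar> * norm (A ** A)"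
      by (metis norm_triangle_ineq norm_scaleR)
    also have "\<dots> \<le> \<theta> / 2 * (\<theta> * H) + 1 / 2 * ((\<theta> * H) * (\<theta> * H) * K)"
    proof (intro add_mono mult_mono s c)
      show "norm A \<le> \<theta> * H"
        using H by (simp add: A_def \<theta>_def)
      then have "norm A * norm A * K \<le> \<theta> * H * (\<theta> * H) * K"
        using K(1) H(1) \<theta> by (intro mult_mono) auto
      then show "norm (A ** A) \<le> \<theta> * H * (\<theta> * H) * K"
        using K(2)[of A A] by linarith
    qed (use \<theta> in auto)
    also have "\<dots> = (H / 2 + H\<^sup>2 * K / 2) * \<theta>\<^sup>2"
      by (simp add: algebra_simps power2_eq_square)
    finally show ?thesis
      by (simp add: A_def \<theta>_def)
  qed
  then show ?thesis
    using H(1) K(1) by (intro exI[of _ "H / 2 + H\<^sup>2 * K / 2"]) auto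
qed

section \<open>The linear solve and the update of the velocity\<close>

lemma matrix_inv_right:
  fixes A :: "real^'n^'n"
  assumes "invertible A"
  shows "A ** matrix_inv A = mat 1"
  using someI_ex[OF assms[unfolded invertible_def]] by (simp add: matrix_inv_def)

text \<open>Pairing the image of \<open>x\<close> with \<open>x\<close> gives at least
  \<open>m\<close> times the squared norm, since \<open>D\<close> contributes a nonnegative amount;
  Cauchy-Schwarz then gives the bound and with it a trivial kernel. As the bound does not depend on
  \<open>h\<close>, errors in the solve can be read off from residuals uniformly in
  \<open>h\<close>.\<close>

lemma shifted_pos_def:
  fixes D :: "real^'n^'n"
  assumes "m > 0" "pos_def D" "h > 0"
  shows "m * norm x \<le> norm ((m *\<^sub>R mat 1 + h *\<^sub>R D) *v x)"
    and "invertible (m *\<^sub>R mat 1 + h *\<^sub>R D)"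
proof -
  let ?M = "m *\<^sub>R mat 1 + h *\<^sub>R D"
  have Mx: "?M *v x = m *\<^sub>R x + h *\<^sub>R (D *v x)" for x
    by (simp add: matrix_vector_mult_add_rdistrib flip: scaleR_matrix_vector_assoc)
  have bound: "m * norm x \<le> norm (?M *v x)" for x
  proof (cases "x = 0")
    case False
    have "m * norm x * norm x \<le> m * norm x * norm x + h * (x \<bullet> (D *v x))"
      using False assms by (simp add: pos_def_def less_imp_le)
    also have "\<dots> = x \<bullet> (?M *v x)"
      unfolding Mx by (simp add: inner_add_right power2_norm_eq_inner[symmetric] power2_eq_square)
    also have "\<dots> \<le> norm (?M *v x) * norm x"
      using norm_cauchy_schwarz[of x "?M *v x"] by (simp add: mult.commute)
    finally show ?thesis
      using False by simp
  qed simp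
  then show "m * norm x \<le> norm (?M *v x)" .
  have "x = 0" if "?M *v x = 0" for x
    using bound[of x] that \<open>m > 0\<close> by (simp add: mult_le_0_iff)
  then show "invertible ?M"
    by (simp add: invertible_left_inverse matrix_left_invertible_ker)
qed

lemma mexp_minus_hat: "mexp (- (h *\<^sub>R hat a)) = mexp (hat (- h *\<^sub>R a))"
  by (simp add: linear_scale[OF linear_hat] linear_neg[OF linear_hat])

text \<open>The velocity component of the filter step, with the forcing vector as a free argument so
  that its estimates do not involve the measurements. \<open>velocity_rate\<close> is the
  corresponding component of the vector field.\<close>

definition velocity_step :: "real \<Rightarrow> real^3^3 \<Rightarrow> real \<Rightarrow> real^3 \<Rightarrow> real^3 \<Rightarrow> real^3 \<Rightarrow> real^3" where
  "velocity_step m D h \<Omega> \<omega> F = matrix_inv (m *\<^sub>R mat 1 + h *\<^sub>R D) *v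
    (mexp (- (h *\<^sub>R hat \<Omega>)) *v (m *\<^sub>R \<omega>) + h *\<^sub>R F)"

definition velocity_rate :: "real \<Rightarrow> real^3^3 \<Rightarrow> real^3 \<Rightarrow> real^3 \<Rightarrow> real^3 \<Rightarrow> real^3" where
  "velocity_rate m D \<Omega> \<omega> F = (1 / m) *\<^sub>R (- (m *\<^sub>R cross3 \<Omega> \<omega>) + F - D *v \<omega>)"

lemma velocity_step_mult:
  assumes "m > 0" "pos_def D" "h > 0"
  shows "(m *\<^sub>R mat 1 + h *\<^sub>R D) *v velocity_step m D h \<Omega> \<omega> F
    = mexp (- (h *\<^sub>R hat \<Omega>)) *v (m *\<^sub>R \<omega>) + h *\<^sub>R F"
  using matrix_inv_right[OF shifted_pos_def(2)[OF assms]]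
  by (simp add: velocity_step_def matrix_vector_mul_assoc)

text \<open>The exponential factor is orthogonal and the inverse of the shifted matrix contracts by
  at least \<open>1 / m\<close>. The bound is therefore independent of \<open>\<Omega>\<close>,
  which itself depends on \<open>\<omega>\<close>; only the forcing can make the velocity
  grow.\<close>

lemma norm_velocity_step_le:
  assumes "m > 0" "pos_def D" "h > 0"
  shows "norm (velocity_step m D h \<Omega> \<omega> F) \<le> norm \<omega> + h * norm F / m"
proof -
  have "orthogonal_matrix (mexp (- (h *\<^sub>R hat \<Omega>)))"
    unfolding mexp_minus_hat using rotation_matrix_mexp_hat rotation_matrix_def by blast
  note norm_orthogonal_matrix_mult[OF this, of "m *\<^sub>R \<omega>"]
  then have "m * norm (velocity_step m D h \<Omega> \<omega> F) \<le> m * norm \<omega> + h * norm F"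
    using shifted_pos_def(1)[OF assms, of "velocity_step m D h \<Omega> \<omega> F"]
      norm_triangle_ineq[of "mexp (- (h *\<^sub>R hat \<Omega>)) *v (m *\<^sub>R \<omega>)" "h *\<^sub>R F"] assms
    by (simp add: velocity_step_mult[OF assms])
  then show ?thesis
    using \<open>m > 0\<close> by (simp add: field_simps)
qed

lemma velocity_rate_bounded:
  assumes "m > 0"
  shows "\<exists>G\<ge>0. \<forall>\<Omega> \<omega> F. norm \<Omega> \<le> r \<longrightarrow> norm \<omega> \<le> r \<longrightarrow> norm F \<le> r \<longrightarrow>
    norm (velocity_rate m D \<Omega> \<omega> F) \<le> G"
proof -
  obtain d where d: "d \<ge> 0" "\<And>x. norm (D *v x) \<le> norm x * d"
    using bounded_linear.nonneg_bounded[OF matrix_vector_mul_bounded_linear[of D]] by blast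
  \<comment> \<open>For negative \<open>r\<close> the claim is vacuous; the absolute value only
    keeps the witness nonnegative in that case. The same device recurs in the expansions
    below.\<close>
  have "norm (velocity_rate m D \<Omega> \<omega> F) \<le> \<bar>(m * (r * r) + r + r * d) / m\<bar>"
    if "norm \<Omega> \<le> r" "norm \<omega> \<le> r" "norm F \<le> r" for \<Omega> \<omega> F
  proof -
    have r: "0 \<le> r" using that(1) norm_ge_zero order_trans by blast
    have "norm (- (m *\<^sub>R cross3 \<Omega> \<omega>) + F - D *v \<omega>)
        \<le> norm (- (m *\<^sub>R cross3 \<Omega> \<omega>)) + norm F + norm (D *v \<omega>)"
      by (meson norm_triangle_ineq norm_triangle_ineq4 order_trans add_right_mono)
    also have "\<dots> \<le> m * (r * r) + r + r * d"
    proof (intro add_mono that)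
      have "norm (cross3 \<Omega> \<omega>) \<le> r * r"
        using norm_cross_le[of \<Omega> \<omega>] mult_mono[OF that(1,2) r] by simp
      then show "norm (- (m *\<^sub>R cross3 \<Omega> \<omega>)) \<le> m * (r * r)"
        using assms by simp
      show "norm (D *v \<omega>) \<le> r * d"
        using d(2)[of \<omega>] mult_right_mono[OF that(2) d(1)] by linarith
    qed
    finally show ?thesis
      using assms r d by (simp add: velocity_rate_def divide_right_mono abs_of_nonneg)
  qed
  then show ?thesis
    by (intro exI[of _ "\<bar>(m * (r * r) + r + r * d) / m\<bar>"]) auto
qed

text \<open>Instead of expanding the inverse matrix in \<open>h\<close>, the error is multiplied by
  \<open>m *\<^sub>R mat 1 + h *\<^sub>R D\<close>. The residual is explicit and of second order,
  and \<open>shifted_pos_def\<close> brings the bound back at the cost of a factor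
  \<open>1 / m\<close>.\<close>

lemma velocity_step_expansion:
  assumes "m > 0" "pos_def D"
  shows "\<exists>C\<ge>0. \<forall>h \<Omega> \<omega> F. 0 < h \<longrightarrow> norm \<Omega> \<le> r \<longrightarrow> norm \<omega> \<le> r \<longrightarrow> norm F \<le> r \<longrightarrow>
    norm (velocity_step m D h \<Omega> \<omega> F - \<omega> - h *\<^sub>R velocity_rate m D \<Omega> \<omega> F) \<le> C * h\<^sup>2"
proof -
  obtain d where d: "d \<ge> 0" "\<And>x. norm (D *v x) \<le> norm x * d"
    using bounded_linear.nonneg_bounded[OF matrix_vector_mul_bounded_linear[of D]] by blast
  obtain G where G: "G \<ge> 0" "\<And>\<Omega> \<omega> F. norm \<Omega> \<le> r \<Longrightarrow> norm \<omega> \<le> r \<Longrightarrow> norm F \<le> r \<Longrightarrow>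
      norm (velocity_rate m D \<Omega> \<omega> F) \<le> G"
    using velocity_rate_bounded[OF assms(1)] by blast
  obtain c where c: "c \<ge> 0" "\<And>a. norm (mexp (hat a) - mat 1 - hat a) \<le> c * (norm a)\<^sup>2"
    using mexp_hat_linearization by blast
  obtain k where k: "k \<ge> 0" "\<And>A x. norm ((A :: real^3^3) *v x) \<le> norm A * norm x * k"
    using bounded_bilinear.nonneg_bounded[OF bounded_bilinear_matrix_vector_mult] by blast
  define C where "C = (c * r\<^sup>2 * (m * r) * k + G * d) / m"
  have "norm (velocity_step m D h \<Omega> \<omega> F - \<omega> - h *\<^sub>R velocity_rate m D \<Omega> \<omega> F) \<le> \<bar>C\<bar> * h\<^sup>2"
    if h: "0 < h" and b: "norm \<Omega> \<le> r" "norm \<omega> \<le> r" "norm F \<le> r" for h \<Omega> \<omega> F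
  proof -
    define g where "g = velocity_rate m D \<Omega> \<omega> F"
    let ?M = "m *\<^sub>R mat 1 + h *\<^sub>R D"
    let ?X = "mexp (- (h *\<^sub>R hat \<Omega>)) - mat 1 - hat (- h *\<^sub>R \<Omega>)"
    have r: "0 \<le> r" using b(1) norm_ge_zero order_trans by blast
    have mg: "m *\<^sub>R g = - (m *\<^sub>R cross3 \<Omega> \<omega>) + F - D *v \<omega>"
      using assms(1) by (simp add: g_def velocity_rate_def)
    have "?M *v (velocity_step m D h \<Omega> \<omega> F - \<omega> - h *\<^sub>R g)
      = (mexp (- (h *\<^sub>R hat \<Omega>)) *v (m *\<^sub>R \<omega>) + h *\<^sub>R F)
        - m *\<^sub>R \<omega> - h *\<^sub>R (D *v \<omega>) - h *\<^sub>R (m *\<^sub>R g) - h\<^sup>2 *\<^sub>R (D *v g)"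
      unfolding matrix_vector_mult_diff_distrib velocity_step_mult[OF assms h]
      by (simp add: matrix_vector_mult_add_rdistrib matrix_vector_mult_scaleR power2_eq_square
          algebra_simps flip: scaleR_matrix_vector_assoc)
    \<comment> \<open>Inserting \<open>mg\<close> cancels the terms with \<open>F\<close> and with
      \<open>D *v \<omega>\<close>; the cross product term is exactly the linear part of the
      exponential, so only its quadratic remainder \<open>?X\<close> survives.\<close>
    also have "\<dots> = ?X *v (m *\<^sub>R \<omega>) - h\<^sup>2 *\<^sub>R (D *v g)"
      unfolding mg by (simp add: matrix_vector_mult_diff_rdistrib cross_mult_left cross_mult_right
          scaleR_add_right scaleR_diff_right)
    finally have eq: "?M *v (velocity_step m D h \<Omega> \<omega> F - \<omega> - h *\<^sub>R g)
      = ?X *v (m *\<^sub>R \<omega>) - h\<^sup>2 *\<^sub>R (D *v g)" .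
    have X: "norm ?X \<le> c * (h\<^sup>2 * r\<^sup>2)"
    proof -
      have "(norm (- h *\<^sub>R \<Omega>))\<^sup>2 \<le> h\<^sup>2 * r\<^sup>2"
        using power_mono[OF b(1), of 2] by (simp add: power_mult_distrib mult_left_mono)
      then show ?thesis
        using c(2)[of "- h *\<^sub>R \<Omega>"] mult_left_mono[OF _ c(1)]
        unfolding mexp_minus_hat by (meson order_trans)
    qed
    have "m * norm (velocity_step m D h \<Omega> \<omega> F - \<omega> - h *\<^sub>R g)
        \<le> norm (?X *v (m *\<^sub>R \<omega>)) + norm (h\<^sup>2 *\<^sub>R (D *v g))"
      using shifted_pos_def(1)[OF assms h, of "velocity_step m D h \<Omega> \<omega> F - \<omega> - h *\<^sub>R g"]
      unfolding eq using norm_triangle_ineq4 order_trans by blast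
    also have "\<dots> \<le> c * (h\<^sup>2 * r\<^sup>2) * (m * r) * k + h\<^sup>2 * (G * d)"
    proof (rule add_mono)
      have "norm ?X * norm (m *\<^sub>R \<omega>) * k \<le> c * (h\<^sup>2 * r\<^sup>2) * (m * r) * k"
        using assms(1) b(2) r c(1) k(1) X by (intro mult_mono) auto
      then show "norm (?X *v (m *\<^sub>R \<omega>)) \<le> c * (h\<^sup>2 * r\<^sup>2) * (m * r) * k"
        using k(2)[of ?X "m *\<^sub>R \<omega>"] by linarith
      have "norm (D *v g) \<le> G * d"
        using d(2)[of g] mult_right_mono[OF G(2)[OF b] d(1)] by (simp add: g_def)
      then show "norm (h\<^sup>2 *\<^sub>R (D *v g)) \<le> h\<^sup>2 * (G * d)"
        by (simp add: mult_left_mono)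
    qed
    also have "\<dots> = m * (C * h\<^sup>2)"
      using assms(1) by (simp add: C_def field_simps)
    finally have "norm (velocity_step m D h \<Omega> \<omega> F - \<omega> - h *\<^sub>R g) \<le> C * h\<^sup>2"
      using assms(1) by simp
    also have "\<dots> \<le> \<bar>C\<bar> * h\<^sup>2"
      by (simp add: mult_right_mono)
    finally show ?thesis
      by (simp add: g_def)
  qed
  then show ?thesis
    by (intro exI[of _ "\<bar>C\<bar>"]) auto
qed

text \<open>The filter exponentiates the angular velocity \<open>a\<close> at the new time, whereas
  the field is evaluated with the velocity \<open>b\<close> at the old time. Their difference of
  order \<open>h\<close> is multiplied by another \<open>h\<close>, so it is absorbed in the second
  order error.\<close>

lemma attitude_step_expansion:
  "\<exists>C\<ge>0. \<forall>h (R :: real^3^3) a b. 0 < h \<longrightarrow> norm R \<le> \<rho> \<longrightarrow> norm a \<le> r \<longrightarrow> norm (a - b) \<le> B * h \<longrightarrow>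
    norm (R ** mexp (h *\<^sub>R hat a) - R - h *\<^sub>R (R ** hat b)) \<le> C * h\<^sup>2"
proof -
  obtain H where H: "H \<ge> 0" "\<And>a. norm (hat a) \<le> norm a * H"
    using bounded_linear.nonneg_bounded[OF bounded_linear_hat] by blast
  obtain K where K: "K \<ge> 0" "\<And>A B. norm ((A :: real^3^3) ** (B :: real^3^3)) \<le> norm A * norm B * K"
    using bounded_bilinear.nonneg_bounded[OF bounded_bilinear_matrix_mult] by blast
  obtain c where c: "c \<ge> 0" "\<And>a. norm (mexp (hat a) - mat 1 - hat a) \<le> c * (norm a)\<^sup>2"
    using mexp_hat_linearization by blast
  define C where "C = \<rho> * (c * r\<^sup>2 + B * H) * K"
  have "norm (R ** mexp (h *\<^sub>R hat a) - R - h *\<^sub>R (R ** hat b)) \<le> \<bar>C\<bar> * h\<^sup>2"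
    if h: "0 < h" and *: "norm R \<le> \<rho>" "norm a \<le> r" "norm (a - b) \<le> B * h" for h a b and R :: "real^3^3"
  proof -
    let ?X = "mexp (hat (h *\<^sub>R a)) - mat 1 - hat (h *\<^sub>R a)"
    have "norm ?X \<le> c * (h\<^sup>2 * r\<^sup>2)"
    proof -
      have "(norm (h *\<^sub>R a))\<^sup>2 \<le> h\<^sup>2 * r\<^sup>2"
        using power_mono[OF *(2), of 2] by (simp add: power_mult_distrib mult_left_mono)
      then show ?thesis
        using c(2)[of "h *\<^sub>R a"] mult_left_mono[OF _ c(1)] by (meson order_trans)
    qed
    moreover have "norm (h *\<^sub>R hat (a - b)) \<le> h * (B * h * H)"
      using H(2)[of "a - b"] mult_right_mono[OF *(3) H(1)] h by simp
    ultimately have X: "norm (?X + h *\<^sub>R hat (a - b)) \<le> c * (h\<^sup>2 * r\<^sup>2) + h * (B * h * H)"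
      by (rule norm_triangle_mono)
    have "R ** mexp (h *\<^sub>R hat a) - R - h *\<^sub>R (R ** hat b) = R ** (?X + h *\<^sub>R hat (a - b))"
      unfolding linear_scale[OF linear_hat] linear_diff[OF linear_hat]
      by (simp add: bounded_bilinear.diff_right[OF bounded_bilinear_matrix_mult]
          bounded_bilinear.scaleR_right[OF bounded_bilinear_matrix_mult]
          matrix_add_ldistrib algebra_simps)
    also have "norm \<dots> \<le> norm R * norm (?X + h *\<^sub>R hat (a - b)) * K"
      by (rule K(2))
    also have "\<dots> \<le> \<rho> * (c * (h\<^sup>2 * r\<^sup>2) + h * (B * h * H)) * K"
      using *(1) X K(1) order_trans[OF norm_ge_zero *(1)] order_trans[OF norm_ge_zero X]
      by (intro mult_mono mult_nonneg_nonneg) auto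
    also have "\<dots> = C * h\<^sup>2"
      by (simp add: C_def power2_eq_square algebra_simps)
    also have "\<dots> \<le> \<bar>C\<bar> * h\<^sup>2"
      by (simp add: mult_right_mono)
    finally show ?thesis .
  qed
  then show ?thesis
    by (intro exI[of _ "\<bar>C\<bar>"]) auto
qed


section \<open>Lipschitz dependence and global error\<close>

text \<open>Hiding the constant lets Lipschitz continuity of composite expressions be derived by
  chaining closure rules, without computing constants.\<close>

definition lipschitzian :: "'a::metric_space set \<Rightarrow> ('a \<Rightarrow> 'b::metric_space) \<Rightarrow> bool" where
  "lipschitzian S f \<longleftrightarrow> (\<exists>B. B-lipschitz_on S f)"

lemma lipschitzianI: "B-lipschitz_on S f \<Longrightarrow> lipschitzian S f"
  unfolding lipschitzian_def by blast

lemma lipschitzian_id: "lipschitzian S (\<lambda>x. x)"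
  by (rule lipschitzianI[OF lipschitz_on_id])

lemma lipschitzian_bounded_linear:
  assumes "bounded_linear T" "lipschitzian S f"
  shows "lipschitzian S (\<lambda>x. T (f x))"
proof -
  obtain B where "B-lipschitz_on S f"
    using assms(2) by (auto simp: lipschitzian_def)
  moreover obtain C where "C-lipschitz_on (f ` S) T"
    using bounded_linear.lipschitz_boundE[OF assms(1)] .
  ultimately show ?thesis
    by (rule lipschitzianI[OF lipschitz_on_compose2])
qed

lemma lipschitzian_linear:
  fixes T :: "'b::euclidean_space \<Rightarrow> 'c::real_normed_vector"
  assumes "linear T" "lipschitzian S f"
  shows "lipschitzian S (\<lambda>x. T (f x))"
  using assms lipschitzian_bounded_linear linear_conv_bounded_linear by blast

lemma lipschitzian_add:
  fixes f g :: "_ \<Rightarrow> 'b::real_normed_vector"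
  assumes "lipschitzian S f" "lipschitzian S g"
  shows "lipschitzian S (\<lambda>x. f x + g x)"
  using assms lipschitz_on_add unfolding lipschitzian_def by blast

lemma lipschitzian_diff:
  fixes f g :: "_ \<Rightarrow> 'b::real_normed_vector"
  assumes "lipschitzian S f" "lipschitzian S g"
  shows "lipschitzian S (\<lambda>x. f x - g x)"
  using assms lipschitz_on_diff unfolding lipschitzian_def by blast

lemma lipschitzian_Pair:
  assumes "lipschitzian S f" "lipschitzian S g"
  shows "lipschitzian S (\<lambda>x. (f x, g x))"
  using assms lipschitz_on_Pair unfolding lipschitzian_def by blast

lemma lipschitzian_compose:
  assumes "lipschitzian S f" "lipschitzian U g" "f ` S \<subseteq> U"
  shows "lipschitzian S (\<lambda>x. g (f x))"
proof -
  obtain B C where B: "B-lipschitz_on S f" and C: "C-lipschitz_on U g"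
    using assms(1,2) by (auto simp: lipschitzian_def)
  show ?thesis
    by (rule lipschitzianI[OF lipschitz_on_compose2[OF B lipschitz_on_subset[OF C assms(3)]]])
qed

lemma lipschitzian_bounded:
  assumes "lipschitzian S f" "bounded S"
  shows "bounded (f ` S)"
proof (cases "S = {}")
  case False
  then obtain x where x: "x \<in> S" by blast
  obtain L where L: "L-lipschitz_on S f"
    using assms(1) by (auto simp: lipschitzian_def)
  obtain e where e: "\<And>y. y \<in> S \<Longrightarrow> dist x y \<le> e"
    using assms(2) bounded_any_center by metis
  have "dist (f x) (f y) \<le> L * e" if "y \<in> S" for y
    using lipschitz_onD[OF L x that] mult_left_mono[OF e[OF that] lipschitz_on_nonneg[OF L]]
    by linarith
  then show ?thesis
    unfolding bounded_def by blast
qed simp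

text \<open>The difference of two products is split by changing one factor at a time. The remaining
  factor must be bounded, which is where boundedness of \<open>S\<close> enters.\<close>

lemma lipschitzian_bilinear:
  assumes "bounded_bilinear p" "bounded S" "lipschitzian S f" "lipschitzian S g"
  shows "lipschitzian S (\<lambda>x. p (f x) (g x))"
proof -
  interpret bounded_bilinear p by fact
  obtain K where K: "K \<ge> 0" "\<And>a b. norm (p a b) \<le> norm a * norm b * K"
    using nonneg_bounded by blast
  obtain F where F: "F > 0" "\<And>x. x \<in> S \<Longrightarrow> norm (f x) \<le> F"
    using lipschitzian_bounded[OF assms(3,2)] by (auto simp: bounded_pos)
  obtain G where G: "G > 0" "\<And>x. x \<in> S \<Longrightarrow> norm (g x) \<le> G"
    using lipschitzian_bounded[OF assms(4,2)] by (auto simp: bounded_pos)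
  obtain A where A: "A-lipschitz_on S f" using assms(3) by (auto simp: lipschitzian_def)
  obtain B where B: "B-lipschitz_on S g" using assms(4) by (auto simp: lipschitzian_def)
  note pos = lipschitz_on_nonneg[OF A] lipschitz_on_nonneg[OF B] K(1) F(1) G(1)
  have "((F * B + A * G) * K)-lipschitz_on S (\<lambda>x. p (f x) (g x))"
  proof (rule lipschitz_onI)
    fix x y assume xy: "x \<in> S" "y \<in> S"
    have "p (f x) (g x) - p (f y) (g y) = p (f x) (g x - g y) + p (f x - f y) (g y)"
      by (simp add: diff_left diff_right)
    then have "dist (p (f x) (g x)) (p (f y) (g y))
      \<le> norm (f x) * norm (g x - g y) * K + norm (f x - f y) * norm (g y) * K"
      unfolding dist_norm by (metis K(2) norm_triangle_mono)
    also have "\<dots> \<le> F * (B * dist x y) * K + (A * dist x y) * G * K"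
      using F(2)[OF xy(1)] G(2)[OF xy(2)] lipschitz_onD[OF A xy] lipschitz_onD[OF B xy] pos
      by (intro add_mono mult_mono) (auto simp: dist_norm)
    finally show "dist (p (f x) (g x)) (p (f y) (g y)) \<le> (F * B + A * G) * K * dist x y"
      by (simp add: algebra_simps)
  qed (use pos in simp)
  then show ?thesis
    by (auto simp: lipschitzian_def)
qed

section \<open>Lipschitz dependence of the forcing term on time and attitude\<close>

lemma trace_inner_weighted_nonneg:
  fixes A :: "real^'n^'m"
  assumes "pos_def W"
  shows "0 \<le> trace_inner A (A ** W)"
proof -
  \<comment> \<open>Cyclicity of the trace turns the weighted inner product into a sum of values of
    the quadratic form of \<open>W\<close> on the rows of \<open>A\<close>.\<close>
  have "trace_inner A (A ** W) = trace ((A ** W) ** transpose A)"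
    unfolding trace_inner_def by (rule trace_mul_sym)
  also have "\<dots> = (\<Sum>i\<in>UNIV. (W *v (A $ i)) \<bullet> (A $ i))"
  proof -
    have W: "W $ k $ j = W $ j $ k" for k j
      using assms by (simp add: pos_def_def transpose_def vec_eq_iff)
    have "((A ** W) ** transpose A) $ i $ i = (W *v (A $ i)) \<bullet> (A $ i)" for i
      by (simp add: matrix_matrix_mult_def matrix_vector_mult_def transpose_def inner_vec_def
          W mult.commute)
    then show ?thesis
      by (simp add: trace_def)
  qed
  also have "\<dots> \<ge> 0"
  proof (rule sum_nonneg)
    fix i show "0 \<le> (W *v (A $ i)) \<bullet> (A $ i)"
      using assms by (cases "A $ i = 0") (auto simp: pos_def_def inner_commute less_imp_le)
  qed
  finally show ?thesis .
qed

lemma wahba_cost_nonneg: "pos_def W \<Longrightarrow> 0 \<le> wahba_cost E W Um R"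
  using trace_inner_weighted_nonneg by (simp add: wahba_cost_def)

text \<open>The second derivative of \<open>\<Phi>\<close> is continuous, hence bounded on a compact
  interval, and the mean value inequality applies. The interval starts at 0 because the derivatives
  are known only on the nonnegative axis.\<close>

lemma potential_shape_lipschitzian:
  assumes "potential_shape \<Phi> \<Phi>'"
  shows "lipschitzian {0..M} \<Phi>'"
proof -
  obtain \<Phi>'' where d: "\<And>x. x \<ge> 0 \<Longrightarrow> (\<Phi>' has_real_derivative \<Phi>'' x) (at x within {0..})"
    and c: "continuous_on {0..} \<Phi>''"
    using assms by (auto simp: potential_shape_def)
  have "compact (\<Phi>'' ` {0..M})"
    by (intro compact_continuous_image continuous_on_subset[OF c]) auto
  then obtain B where B: "B > 0" "\<And>x. x \<in> {0..M} \<Longrightarrow> norm (\<Phi>'' x) \<le> B"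
    using compact_imp_bounded[THEN bounded_pos[THEN iffD1]] by (metis imageI)
  have "norm (\<Phi>' x - \<Phi>' y) \<le> B * norm (x - y)" if "x \<in> {0..M}" "y \<in> {0..M}" for x y
  proof (rule field_differentiable_bound[of "{0..M}"])
    show "(\<Phi>' has_field_derivative \<Phi>'' z) (at z within {0..M})" if "z \<in> {0..M}" for z
      using d[of z] that by (auto intro: DERIV_subset)
  qed (use that B in auto)
  then have "B-lipschitz_on {0..M} \<Phi>'"
    using B(1) by (intro lipschitz_onI) (auto simp: dist_norm)
  then show ?thesis
    by (auto simp: lipschitzian_def)
qed

text \<open>The argument of \<open>vex\<close> in \<open>S_vec\<close> is skew-symmetric, so
  \<open>vex_skew\<close> applies and the Lipschitz rules for linear maps become available.\<close>

lemma S_vec_components: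
  "S_vec L R = (\<lambda>A. vector [A$3$2, A$1$3, A$2$1]) (transpose L ** R - transpose R ** L)"
proof -
  have "transpose (transpose L ** R - transpose R ** L) = - (transpose L ** R - transpose R ** L)"
    by (simp add: transpose_def matrix_matrix_mult_def vec_eq_iff mult.commute)
  then show ?thesis
    unfolding S_vec_def using vex_skew by simp
qed

lemma linear_transpose: "linear (transpose :: real^'n^'m \<Rightarrow> real^'m^'n)"
  by (rule linearI) (simp_all add: transpose_def vec_eq_iff)

lemma linear_trace: "linear (trace :: real^'n^'n \<Rightarrow> real)"
  by (rule linearI) (simp_all add: trace_def sum.distrib sum_distrib_left)

definition forcing ::
  "(real \<Rightarrow> real) \<Rightarrow> real^'n^3 \<Rightarrow> real^'n^'n \<Rightarrow> real^'n^3 \<Rightarrow> real^3^3 \<Rightarrow> real^3"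
  where "forcing \<Phi>' E W Um R = \<Phi>' (wahba_cost E W Um R) *\<^sub>R S_vec (L_matrix E W Um) R"

lemma lipschitzian_forcing:
  fixes E Um :: "'z::metric_space \<Rightarrow> real^'n^3" and W :: "'z \<Rightarrow> real^'n^'n"
  assumes S: "bounded S" and \<Phi>: "potential_shape \<Phi> \<Phi>'"
    and W: "\<And>z. z \<in> S \<Longrightarrow> pos_def (W z)"
    and lip: "lipschitzian S E" "lipschitzian S W" "lipschitzian S Um" "lipschitzian S R"
  shows "lipschitzian S (\<lambda>z. forcing \<Phi>' (E z) (W z) (Um z) (R z))"
proof -
  note mult = lipschitzian_bilinear[OF bounded_bilinear_matrix_mult S]
  note transp = lipschitzian_linear[OF linear_transpose]
  have L: "lipschitzian S (\<lambda>z. L_matrix (E z) (W z) (Um z))"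
    unfolding L_matrix_def by (intro mult transp lip)
  have "linear (\<lambda>A :: real^3^3. vector [A$3$2, A$1$3, A$2$1] :: real^3)"
    by (rule linearI) (simp_all add: vec_eq_iff forall_3)
  note vexlin = lipschitzian_linear[OF this]
  have Sv: "lipschitzian S (\<lambda>z. S_vec (L_matrix (E z) (W z) (Um z)) (R z))"
    unfolding S_vec_components by (intro vexlin lipschitzian_diff mult transp lip L)
  have cost: "lipschitzian S (\<lambda>z. wahba_cost (E z) (W z) (Um z) (R z))"
    unfolding wahba_cost_def trace_inner_def
    by (intro lipschitzian_bounded_linear[OF bounded_linear_mult_right]
        lipschitzian_linear[OF linear_trace] mult transp lip lipschitzian_diff)
  then obtain M where "\<And>z. z \<in> S \<Longrightarrow> norm (wahba_cost (E z) (W z) (Um z) (R z)) \<le> M"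
    using lipschitzian_bounded[OF cost S] by (auto simp: bounded_iff)
  \<comment> \<open>Positive definite weights keep the cost nonnegative, so its values lie where the
    Lipschitz bound for \<open>\<Phi>'\<close> holds.\<close>
  then have "(\<lambda>z. wahba_cost (E z) (W z) (Um z) (R z)) ` S \<subseteq> {0..M}"
    using wahba_cost_nonneg[OF W] by (auto simp: abs_le_iff)
  then have "lipschitzian S (\<lambda>z. \<Phi>' (wahba_cost (E z) (W z) (Um z) (R z)))"
    by (rule lipschitzian_compose[OF cost potential_shape_lipschitzian[OF \<Phi>]])
  then show ?thesis
    unfolding forcing_def by (intro lipschitzian_bilinear[OF bounded_bilinear_scaleR S] Sv)
qed

text \<open>\<open>K\<close> has to contain both the exact solution and all iterates, which replaces
  a global Lipschitz condition on \<open>f\<close>. Stability is taken from \<open>f\<close>: the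
  method enters only through its distance to an Euler step.\<close>

lemma one_step_order_1:
  fixes f :: "real \<Rightarrow> 'a \<Rightarrow> 'a::real_normed_vector"
  assumes "t\<^sub>0 < T"
    and lip: "L-lipschitz_on ({t\<^sub>0..T} \<times> K) (\<lambda>(t, x). f t x)"
    and bnd: "\<And>t x. t \<in> {t\<^sub>0..T} \<Longrightarrow> x \<in> K \<Longrightarrow> norm (f t x) \<le> G"
    and step: "\<And>t h x. t\<^sub>0 \<le> t \<Longrightarrow> 0 < h \<Longrightarrow> t + h \<le> T \<Longrightarrow> x \<in> K \<Longrightarrow>
      norm (\<Psi> h t x - x - h *\<^sub>R f t x) \<le> C * h\<^sup>2"
    and sol: "solves_ode_on f t\<^sub>0 T y" and yK: "\<And>t. t \<in> {t\<^sub>0..T} \<Longrightarrow> y t \<in> K"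
    and iter: "\<And>N i. 1 \<le> N \<Longrightarrow> i \<le> N \<Longrightarrow> one_step_iter \<Psi> ((T - t\<^sub>0) / real N) t\<^sub>0 (y t\<^sub>0) i \<in> K"
  shows "consistent_of_order 1 \<Psi> t\<^sub>0 T y" and "convergent_of_order 1 \<Psi> t\<^sub>0 T y"
proof -
  have L: "L \<ge> 0" using lipschitz_on_nonneg[OF lip] .
  have "norm (f t\<^sub>0 (y t\<^sub>0)) \<le> G" using \<open>t\<^sub>0 < T\<close> yK bnd by simp
  then have G: "G \<ge> 0" using norm_ge_zero order_trans by blast
  have y_lip: "norm (y s - y t) \<le> G * norm (s - t)" if "s \<in> {t\<^sub>0..T}" "t \<in> {t\<^sub>0..T}" for s t
  proof (rule differentiable_bound[of "{t\<^sub>0..T}"])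
    show "(y has_derivative (\<lambda>h. h *\<^sub>R f z (y z))) (at z within {t\<^sub>0..T})" if "z \<in> {t\<^sub>0..T}" for z
      using sol that by (auto simp: solves_ode_on_def has_vector_derivative_def)
    show "onorm (\<lambda>h. h *\<^sub>R f z (y z)) \<le> G" if "z \<in> {t\<^sub>0..T}" for z
      using bnd[OF that yK[OF that]] by (intro onorm_le) (simp add: mult.commute[of G] mult_left_mono)
  qed (use that in auto)
  define C' where "C' = \<bar>C\<bar> + L * (1 + G)"
  have C': "C' \<ge> 0" using L G by (simp add: C'_def)
  \<comment> \<open>The curve of pairs of time and state has Lipschitz constant at most
    \<open>1 + G\<close>, so along it the derivative of \<open>y\<close> varies by at most
    \<open>L * (1 + G) * h\<close> over one step. This takes the place of a bound on a second
    derivative.\<close>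
  have euler: "norm (y (t + h) - y t - h *\<^sub>R f t (y t)) \<le> L * (1 + G) * h\<^sup>2"
    if "t\<^sub>0 \<le> t" "0 < h" "t + h \<le> T" for t h
  proof -
    have "norm (y (t + h) - y t - (t + h - t) *\<^sub>R f t (y t)) \<le> norm (t + h - t) * (L * ((1 + G) * h))"
    proof (rule vector_differentiable_bound_linearization[of "{t..t + h}" y "\<lambda>s. f s (y s)"])
      fix s assume s: "s \<in> {t..t + h}"
      then have sT: "s \<in> {t\<^sub>0..T}" "t \<in> {t\<^sub>0..T}" using that by auto
      show "(y has_vector_derivative f s (y s)) (at s within {t..t + h})"
        using sol sT that unfolding solves_ode_on_def
        by (elim ballE[of _ _ s] has_vector_derivative_within_subset) auto
      have "norm (f s (y s) - f t (y t)) \<le> L * norm ((s, y s) - (t, y t))"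
        using lipschitz_on_normD[OF lip, of "(s, y s)" "(t, y t)"] sT yK by simp
      also have "\<dots> \<le> L * (norm (s - t) + norm (y s - y t))"
        using L norm_Pair_le[of "s - t" "y s - y t"] by (intro mult_left_mono) auto
      also have "\<dots> \<le> L * ((1 + G) * h)"
      proof (intro mult_left_mono L)
        have "norm (s - t) \<le> h" using s by auto
        moreover have "G * norm (s - t) \<le> G * h" using calculation G by (rule mult_left_mono)
        ultimately show "norm (s - t) + norm (y s - y t) \<le> (1 + G) * h"
          using y_lip[OF sT] by (simp add: algebra_simps)
      qed
      finally show "norm (f s (y s) - f t (y t)) \<le> L * ((1 + G) * h)" .
    qed (use that in \<open>auto simp: closed_segment_eq_real_ivl\<close>)
    then show ?thesis
      using that by (simp add: power2_eq_square algebra_simps)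
  qed
  \<comment> \<open>Stated for an arbitrary \<open>x\<close> in \<open>K\<close> so as to serve
    twice: with \<open>x = y t\<close> it is the local error, and with \<open>x\<close> an iterate
    it is the recursion for the global error.\<close>
  have local: "norm (\<Psi> h t x - y (t + h) - (x - y t) - h *\<^sub>R (f t x - f t (y t))) \<le> C' * h\<^sup>2"
    if "t\<^sub>0 \<le> t" "0 < h" "t + h \<le> T" "x \<in> K" for t h x
  proof -
    have "C * h\<^sup>2 \<le> \<bar>C\<bar> * h\<^sup>2" by (simp add: mult_right_mono)
    moreover have "\<Psi> h t x - y (t + h) - (x - y t) - h *\<^sub>R (f t x - f t (y t))
      = (\<Psi> h t x - x - h *\<^sub>R f t x) - (y (t + h) - y t - h *\<^sub>R f t (y t))"
      by (simp add: algebra_simps)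
    ultimately show ?thesis
      using norm_triangle_ineq4[of "\<Psi> h t x - x - h *\<^sub>R f t x" "y (t + h) - y t - h *\<^sub>R f t (y t)"]
        step[OF that] euler[OF that(1-3)]
      by (simp add: C'_def algebra_simps)
  qed
  show "consistent_of_order 1 \<Psi> t\<^sub>0 T y"
    unfolding consistent_of_order_def
  proof (intro exI allI impI)
    fix t h assume "t\<^sub>0 \<le> t" "0 < h" "t + h \<le> T"
    then show "norm (\<Psi> h t (y t) - y (t + h)) \<le> C' * h ^ (1 + 1)"
      using local[of t h "y t"] yK[of t] by (simp add: power2_eq_square)
  qed
  show "convergent_of_order 1 \<Psi> t\<^sub>0 T y"
    unfolding convergent_of_order_def
  proof (intro exI allI impI)
    fix N :: nat and h i assume N: "N \<ge> 1" and h: "h = (T - t\<^sub>0) / real N" and i: "i \<le> N"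
    have hpos: "h > 0" using N h \<open>t\<^sub>0 < T\<close> by simp
    have hN: "real j * h \<le> T - t\<^sub>0" if "j \<le> N" for j
    proof -
      have "real j * h \<le> real N * h" using that hpos by simp
      then show ?thesis using N h by simp
    qed
    define x where "x = one_step_iter \<Psi> h t\<^sub>0 (y t\<^sub>0)"
    \<comment> \<open>Discrete Gronwall: \<open>j\<close> local errors have accumulated, each
      amplified by at most the full factor. This is coarser than the geometric sum but avoids
      dividing by \<open>L\<close>, which may be 0.\<close>
    have "norm (x j - y (t\<^sub>0 + real j * h)) \<le> real j * h\<^sup>2 * C' * (1 + L * h) ^ j" if "j \<le> N" for j
      using that
    proof (induction j)
      case 0
      then show ?case by (simp add: x_def)
    next
      case (Suc j)
      define t e where "t = t\<^sub>0 + real j * h" and "e = x j - y t"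
      have t: "t \<in> {t\<^sub>0..T}" "t\<^sub>0 \<le> t" "t + h \<le> T" "t\<^sub>0 + real (Suc j) * h = t + h"
        using hN[of j] hN[of "Suc j"] Suc.prems hpos by (auto simp: t_def algebra_simps)
      have xK: "x j \<in> K" unfolding x_def h using iter N Suc.prems by simp
      have one: "1 \<le> (1 + L * h) ^ Suc j" using L hpos by (simp add: one_le_power del: power_Suc)
      have "norm (f t (x j) - f t (y t)) \<le> L * norm e"
        using lipschitz_on_normD[OF lip, of "(t, x j)" "(t, y t)"] xK yK t
        by (simp add: e_def norm_Pair)
      then have "norm (h *\<^sub>R (f t (x j) - f t (y t))) \<le> h * (L * norm e)"
        using hpos by (simp add: mult_left_mono)
      then have "norm (e + h *\<^sub>R (f t (x j) - f t (y t))) \<le> norm e + h * (L * norm e)"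
        by (rule norm_triangle_mono[OF order_refl])
      moreover have "x (Suc j) - y (t + h) = (\<Psi> h t (x j) - y (t + h) - (x j - y t)
          - h *\<^sub>R (f t (x j) - f t (y t))) + (e + h *\<^sub>R (f t (x j) - f t (y t)))"
        by (simp add: x_def t_def e_def)
      ultimately have "norm (x (Suc j) - y (t + h)) \<le> C' * h\<^sup>2 + (norm e + h * (L * norm e))"
        using norm_triangle_mono[OF local[OF t(2) hpos t(3) xK]] by metis
      also have "\<dots> = h\<^sup>2 * C' * 1 + (1 + L * h) * norm e"
        by (simp add: algebra_simps)
      \<comment> \<open>The new local error is given the full amplification factor by
        \<open>one\<close>, so that it merges with the \<open>j\<close> earlier ones.\<close>
      also have "\<dots> \<le> h\<^sup>2 * C' * (1 + L * h) ^ Suc j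
          + (1 + L * h) * (real j * h\<^sup>2 * C' * (1 + L * h) ^ j)"
        using Suc.IH Suc.prems one C' L hpos
        by (intro add_mono mult_left_mono) (auto simp: e_def t_def)
      also have "\<dots> = real (Suc j) * h\<^sup>2 * C' * (1 + L * h) ^ Suc j"
        by (simp add: algebra_simps)
      finally show ?case
        unfolding t(4) .
    qed
    then have "norm (x i - y (t\<^sub>0 + real i * h)) \<le> (real i * h) * (1 + L * h) ^ i * (C' * h)"
      using i by (simp add: power2_eq_square mult_ac)
    \<comment> \<open>One power of \<open>h\<close> is spent on \<open>real i * h\<close>, which is
      at most the length of the interval; the amplification is bounded through the inequality
      between \<open>1 + x\<close> and \<open>exp x\<close>.\<close>
    also have "\<dots> \<le> (T - t\<^sub>0) * exp (L * (T - t\<^sub>0)) * (C' * h)"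
    proof -
      have "(1 + L * h) ^ i \<le> exp (L * h) ^ i"
        using L hpos by (intro power_mono exp_ge_add_one_self) simp
      also have "\<dots> = exp (L * (real i * h))"
        by (simp add: exp_of_nat_mult[symmetric] mult_ac)
      also have "\<dots> \<le> exp (L * (T - t\<^sub>0))"
        using hN[OF i] L by (simp add: mult_left_mono)
      finally show ?thesis
        using hN[OF i] hpos L C' \<open>t\<^sub>0 < T\<close> by (intro mult_mono) auto
    qed
    finally show "norm (one_step_iter \<Psi> h t\<^sub>0 (y t\<^sub>0) i - y (t\<^sub>0 + real i * h))
        \<le> ((T - t\<^sub>0) * exp (L * (T - t\<^sub>0)) * C') * h ^ 1"
      by (simp add: x_def mult_ac)
  qed
qed


section \<open>The filter\<close>

lemma filter_step_split:
  "filter_step m D \<Phi>' E W Um \<Omega>m h t (R, \<omega>) =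
    (let \<omega>' = velocity_step m D h (\<Omega>m t - \<omega>) \<omega> (forcing \<Phi>' (E t) (W t) (Um t) R)
     in (R ** mexp (h *\<^sub>R hat (\<Omega>m (t + h) - \<omega>')), \<omega>'))"
  by (simp add: filter_step_def velocity_step_def forcing_def Let_def)

lemma filter_field_split:
  "filter_field m D \<Phi>' E W Um \<Omega>m t (R, \<omega>) =
    (R ** hat (\<Omega>m t - \<omega>), velocity_rate m D (\<Omega>m t - \<omega>) \<omega> (forcing \<Phi>' (E t) (W t) (Um t) R))"
  by (simp add: filter_field_def velocity_rate_def forcing_def Let_def)

lemma rotation_matrix_mult:
  fixes A B :: "real^'n^'n"
  shows "rotation_matrix A \<Longrightarrow> rotation_matrix B \<Longrightarrow> rotation_matrix (A ** B)"
  by (simp add: rotation_matrix_def orthogonal_matrix_mul det_mul)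

lemma rotation_matrix_filter_step:
  assumes "rotation_matrix (fst x)"
  shows "rotation_matrix (fst (filter_step m D \<Phi>' E W Um \<Omega>m h t x))"
  using assms rotation_matrix_mexp_hat
  by (cases x) (simp add: filter_step_split Let_def rotation_matrix_mult flip: linear_scale[OF linear_hat])

lemma rotation_matrix_filter_iter:
  assumes "rotation_matrix (fst x\<^sub>0)"
  shows "rotation_matrix (fst (one_step_iter (filter_step m D \<Phi>' E W Um \<Omega>m) h t\<^sub>0 x\<^sub>0 i))"
  by (induction i) (simp_all add: assms rotation_matrix_filter_step)

locale attitude_filter =
  fixes m t\<^sub>0 T :: real
    and D :: "real^3^3"
    and \<Phi> \<Phi>' :: "real \<Rightarrow> real"
    and E Um :: "real \<Rightarrow> real^'n^3"
    and W :: "real \<Rightarrow> real^'n^'n"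
    and \<Omega>m :: "real \<Rightarrow> real^3"
  assumes less: "t\<^sub>0 < T"
    and m: "m > 0"
    and D: "pos_def D"
    and \<Phi>: "potential_shape \<Phi> \<Phi>'"
    and posW: "\<And>t. t \<in> {t\<^sub>0..T} \<Longrightarrow> pos_def (W t)"
    and lip: "lipschitzian {t\<^sub>0..T} E" "lipschitzian {t\<^sub>0..T} W" "lipschitzian {t\<^sub>0..T} Um"
      "lipschitzian {t\<^sub>0..T} \<Omega>m"
begin

abbreviation "f \<equiv> filter_field m D \<Phi>' E W Um \<Omega>m"
abbreviation "\<Psi> \<equiv> filter_step m D \<Phi>' E W Um \<Omega>m"
abbreviation "F t R \<equiv> forcing \<Phi>' (E t) (W t) (Um t) R"

text \<open>The maps \<open>\<tau>\<close> and \<open>R\<close> extract time and attitude from a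
  point of \<open>S\<close>, so the lemma serves both for pairs of time and attitude and for full
  states with time.\<close>

lemma lipschitzian_force:
  assumes "bounded S" "\<tau> ` S \<subseteq> {t\<^sub>0..T}" "lipschitzian S \<tau>" "lipschitzian S R"
  shows "lipschitzian S (\<lambda>z. F (\<tau> z) (R z))"
proof -
  note comp = lipschitzian_compose[OF assms(3) _ assms(2)]
  show ?thesis
    using assms(2) posW
    by (intro lipschitzian_forcing[OF assms(1) \<Phi> _ comp[OF lip(1)] comp[OF lip(2)] comp[OF lip(3)] assms(4)])
      auto
qed

text \<open>The field contains products of state components such as
  \<open>R ** hat \<Omega>\<close>, hence the restriction to balls. The radii stay free because they
  are chosen later from the solution and the iterates.\<close>

lemma lipschitzian_field:
  "lipschitzian ({t\<^sub>0..T} \<times> (cball 0 \<rho> \<times> cball 0 r)) (\<lambda>(t, x). f t x)"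
proof -
  let ?Z = "{t\<^sub>0..T} \<times> (cball (0 :: real^3^3) \<rho> \<times> cball (0 :: real^3) r)"
  have Z: "bounded ?Z" by (intro bounded_Times bounded_cball compact_imp_bounded[OF compact_Icc])
  note t = lipschitzian_bounded_linear[OF bounded_linear_fst lipschitzian_id[of ?Z]]
  note x = lipschitzian_bounded_linear[OF bounded_linear_snd lipschitzian_id[of ?Z]]
  note R = lipschitzian_bounded_linear[OF bounded_linear_fst x]
  note \<omega> = lipschitzian_bounded_linear[OF bounded_linear_snd x]
  have \<Omega>: "lipschitzian ?Z (\<lambda>z. \<Omega>m (fst z) - snd (snd z))"
    by (intro lipschitzian_diff lipschitzian_compose[OF t lip(4)] \<omega>) auto
  have F: "lipschitzian ?Z (\<lambda>z. F (fst z) (fst (snd z)))"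
    by (intro lipschitzian_force Z t R) auto
  have cross: "bounded_bilinear cross3"
    using bilinear_cross bilinear_conv_bounded_bilinear by blast
  have "lipschitzian ?Z (\<lambda>z. (fst (snd z) ** hat (\<Omega>m (fst z) - snd (snd z)),
    velocity_rate m D (\<Omega>m (fst z) - snd (snd z)) (snd (snd z)) (F (fst z) (fst (snd z)))))"
    unfolding velocity_rate_def
    by (intro lipschitzian_Pair lipschitzian_bilinear[OF bounded_bilinear_matrix_mult Z] R
      lipschitzian_bounded_linear[OF bounded_linear_hat] \<Omega> lipschitzian_bounded_linear[OF bounded_linear_scaleR_right]
      lipschitzian_bounded_linear[OF matrix_vector_mul_bounded_linear]
      lipschitzian_bounded_linear[OF bounded_linear_minus[OF bounded_linear_ident]]
      lipschitzian_diff lipschitzian_add F \<omega> lipschitzian_bilinear[OF cross Z])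
  moreover have "f t x = (fst x ** hat (\<Omega>m t - snd x),
      velocity_rate m D (\<Omega>m t - snd x) (snd x) (F t (fst x)))" for t x
    by (cases x) (simp add: filter_field_split)
  ultimately show ?thesis
    by (simp add: case_prod_unfold)
qed

lemma force_bounded: "\<exists>B\<ge>0. \<forall>t R. t \<in> {t\<^sub>0..T} \<longrightarrow> norm R \<le> \<rho> \<longrightarrow> norm (F t R) \<le> B"
proof -
  let ?S = "{t\<^sub>0..T} \<times> cball (0 :: real^3^3) \<rho>"
  have S: "bounded ?S" by (intro bounded_Times bounded_cball compact_imp_bounded[OF compact_Icc])
  note t = lipschitzian_bounded_linear[OF bounded_linear_fst lipschitzian_id[of ?S]]
  note R = lipschitzian_bounded_linear[OF bounded_linear_snd lipschitzian_id[of ?S]]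
  have "bounded ((\<lambda>z. F (fst z) (snd z)) ` ?S)"
    by (intro lipschitzian_bounded lipschitzian_force S t R) auto
  then obtain B where B: "\<And>z. z \<in> ?S \<Longrightarrow> norm (F (fst z) (snd z)) \<le> B"
    unfolding bounded_iff by blast
  have "norm (F t R) \<le> \<bar>B\<bar>" if "t \<in> {t\<^sub>0..T}" "norm R \<le> \<rho>" for t R
    using B[of "(t, R)"] that by simp
  then show ?thesis
    by (intro exI[of _ "\<bar>B\<bar>"]) auto
qed

text \<open>The order of the updates is followed: first the new velocity is compared with an Euler
  step, then its distance to the old one is fed into \<open>attitude_step_expansion\<close>.\<close>

lemma filter_step_expansion:
  "\<exists>C. \<forall>t h x. t\<^sub>0 \<le> t \<longrightarrow> 0 < h \<longrightarrow> t + h \<le> T \<longrightarrow> x \<in> cball 0 \<rho> \<times> cball 0 r \<longrightarrow>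
    norm (\<Psi> h t x - x - h *\<^sub>R f t x) \<le> C * h\<^sup>2"
proof -
  obtain L where L: "L-lipschitz_on {t\<^sub>0..T} \<Omega>m" using lip(4) by (auto simp: lipschitzian_def)
  obtain BF where BF: "BF \<ge> 0" "\<And>t R. t \<in> {t\<^sub>0..T} \<Longrightarrow> norm R \<le> \<rho> \<Longrightarrow> norm (F t R) \<le> BF"
    using force_bounded by blast
  have "bounded (\<Omega>m ` {t\<^sub>0..T})"
    by (intro lipschitzian_bounded lip) simp
  then obtain B\<Omega> where B\<Omega>: "B\<Omega> > 0" "\<And>t. t \<in> {t\<^sub>0..T} \<Longrightarrow> norm (\<Omega>m t) \<le> B\<Omega>"
    by (auto simp: bounded_pos)
  \<comment> \<open>One bound that dominates \<open>\<Omega>\<close>, \<open>\<omega>\<close> and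
    the forcing at once.\<close>
  define q where "q = BF + B\<Omega> + \<bar>r\<bar>"
  obtain C1 where C1: "C1 \<ge> 0" "\<And>h \<Omega> \<omega> F. 0 < h \<Longrightarrow> norm \<Omega> \<le> q \<Longrightarrow> norm \<omega> \<le> q \<Longrightarrow> norm F \<le> q \<Longrightarrow>
    norm (velocity_step m D h \<Omega> \<omega> F - \<omega> - h *\<^sub>R velocity_rate m D \<Omega> \<omega> F) \<le> C1 * h\<^sup>2"
    using velocity_step_expansion[OF m D] by blast
  obtain G where G: "G \<ge> 0" "\<And>\<Omega> \<omega> F. norm \<Omega> \<le> q \<Longrightarrow> norm \<omega> \<le> q \<Longrightarrow> norm F \<le> q \<Longrightarrow>
      norm (velocity_rate m D \<Omega> \<omega> F) \<le> G"
    using velocity_rate_bounded[OF m] by blast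
  \<comment> \<open>Bounds the change of angular velocity per unit of \<open>h\<close>:
    \<open>L\<close> for the drift of the measurement, \<open>G\<close> for the Euler increment of
    \<open>\<omega>\<close>, and the last summand for its second order remainder, where one factor
    \<open>h\<close> is at most \<open>T - t\<^sub>0\<close>.\<close>
  define A where "A = L + G + C1 * (T - t\<^sub>0)"
  obtain C2 where C2: "C2 \<ge> 0" "\<And>h (R :: real^3^3) a b. 0 < h \<Longrightarrow> norm R \<le> \<rho> \<Longrightarrow>
      norm a \<le> q + A * (T - t\<^sub>0) \<Longrightarrow> norm (a - b) \<le> A * h \<Longrightarrow>
    norm (R ** mexp (h *\<^sub>R hat a) - R - h *\<^sub>R (R ** hat b)) \<le> C2 * h\<^sup>2"
    using attitude_step_expansion[of \<rho> "q + A * (T - t\<^sub>0)" A] by blast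
  have "norm (\<Psi> h t x - x - h *\<^sub>R f t x) \<le> (C2 + C1) * h\<^sup>2"
    if t: "t\<^sub>0 \<le> t" and h: "0 < h" and th: "t + h \<le> T" and x: "x \<in> cball 0 \<rho> \<times> cball 0 r" for t h x
  proof -
    obtain R \<omega> where xR: "x = (R, \<omega>)" and R: "norm R \<le> \<rho>" and \<omega>: "norm \<omega> \<le> r"
      using x by auto
    have tT: "t \<in> {t\<^sub>0..T}" "t + h \<in> {t\<^sub>0..T}" using t h th by auto
    define \<Omega> \<omega>' g where "\<Omega> = \<Omega>m t - \<omega>" and "\<omega>' = velocity_step m D h \<Omega> \<omega> (F t R)"
      and "g = velocity_rate m D \<Omega> \<omega> (F t R)"
    have \<Omega>: "norm \<Omega> \<le> q"
      using B\<Omega>(2)[OF tT(1)] \<omega> BF(1) norm_triangle_ineq4[of "\<Omega>m t" \<omega>] by (simp add: \<Omega>_def q_def)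
    have b: "norm \<omega> \<le> q" "norm (F t R) \<le> q"
      using \<omega> BF(1) BF(2)[OF tT(1) R] B\<Omega>(1) by (auto simp: q_def)
    have v: "norm (\<omega>' - \<omega> - h *\<^sub>R g) \<le> C1 * h\<^sup>2"
      unfolding \<omega>'_def g_def by (rule C1(2)[OF h \<Omega> b])
    let ?a = "\<Omega>m (t + h) - \<omega>'"
    have "C1 * h\<^sup>2 \<le> C1 * (T - t\<^sub>0) * h"
      using t h th C1(1) unfolding power2_eq_square mult.assoc by (intro mult_left_mono mult_right_mono) auto
    moreover have "norm (h *\<^sub>R g) \<le> G * h"
      using G(2)[OF \<Omega> b] h by (simp add: g_def mult.commute[of G])
    moreover have "norm (\<Omega>m (t + h) - \<Omega>m t) \<le> L * h"
      using lipschitz_on_normD[OF L tT(2,1)] h by simp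
    moreover have "norm (?a - \<Omega>) \<le>
        norm (\<Omega>m (t + h) - \<Omega>m t) + norm (h *\<^sub>R g) + norm (\<omega>' - \<omega> - h *\<^sub>R g)"
    proof -
      have "?a - \<Omega> = (\<Omega>m (t + h) - \<Omega>m t) - h *\<^sub>R g - (\<omega>' - \<omega> - h *\<^sub>R g)"
        by (simp add: \<Omega>_def)
      show ?thesis
        unfolding \<open>?a - \<Omega> = _\<close>
        using norm_triangle_ineq4[of "\<Omega>m (t + h) - \<Omega>m t - h *\<^sub>R g" "\<omega>' - \<omega> - h *\<^sub>R g"]
          norm_triangle_ineq4[of "\<Omega>m (t + h) - \<Omega>m t" "h *\<^sub>R g"] by linarith
    qed
    ultimately have a\<Omega>: "norm (?a - \<Omega>) \<le> A * h"
      using v by (simp add: A_def algebra_simps)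
    have "A \<ge> 0"
      using lipschitz_on_nonneg[OF L] G(1) C1(1) less by (simp add: A_def)
    then have "A * h \<le> A * (T - t\<^sub>0)"
      using t th by (intro mult_left_mono) auto
    then have a: "norm ?a \<le> q + A * (T - t\<^sub>0)"
      using norm_triangle_sub[of ?a \<Omega>] \<Omega> a\<Omega> by linarith
    have "\<Psi> h t x - x - h *\<^sub>R f t x =
        (R ** mexp (h *\<^sub>R hat ?a) - R - h *\<^sub>R (R ** hat \<Omega>), \<omega>' - \<omega> - h *\<^sub>R g)"
      by (simp add: xR filter_step_split filter_field_split Let_def \<Omega>_def \<omega>'_def g_def)
    then have "norm (\<Psi> h t x - x - h *\<^sub>R f t x) \<le>
        norm (R ** mexp (h *\<^sub>R hat ?a) - R - h *\<^sub>R (R ** hat \<Omega>)) + norm (\<omega>' - \<omega> - h *\<^sub>R g)"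
      by (simp only: norm_Pair_le)
    then show ?thesis
      using C2(2)[OF h R a a\<Omega>] v by (simp add: algebra_simps)
  qed
  then show ?thesis
    by blast
qed

text \<open>The attitudes are rotations, so the forcing is bounded by a constant \<open>B\<close>
  known in advance. By \<open>norm_velocity_step_le\<close> each step adds at most
  \<open>h * B / m\<close>, and the step lengths sum to at most \<open>T - t\<^sub>0\<close>
  whatever \<open>N\<close> is.\<close>

lemma filter_iter_bounded:
  assumes R0: "rotation_matrix R\<^sub>0"
  shows "\<exists>B. \<forall>N i. 1 \<le> N \<longrightarrow> i \<le> N \<longrightarrow>
    norm (snd (one_step_iter \<Psi> ((T - t\<^sub>0) / real N) t\<^sub>0 (R\<^sub>0, \<omega>\<^sub>0) i)) \<le> B"
proof -
  obtain B where B: "B \<ge> 0" "\<And>t R. t \<in> {t\<^sub>0..T} \<Longrightarrow> norm R \<le> 3 \<Longrightarrow> norm (F t R) \<le> B"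
    using force_bounded by blast
  have "norm (snd (one_step_iter \<Psi> h t\<^sub>0 (R\<^sub>0, \<omega>\<^sub>0) i)) \<le> norm \<omega>\<^sub>0 + (T - t\<^sub>0) * B / m"
    if N: "1 \<le> N" "i \<le> N" and h: "h = (T - t\<^sub>0) / real N" for N i h
  proof -
    have hpos: "h > 0" using N h less by simp
    have hN: "real j * h \<le> T - t\<^sub>0" if "j \<le> N" for j
    proof -
      have "real j * h \<le> real N * h" using that hpos by simp
      then show ?thesis using N h by simp
    qed
    define x where "x = one_step_iter \<Psi> h t\<^sub>0 (R\<^sub>0, \<omega>\<^sub>0)"
    have "norm (snd (x j)) \<le> norm \<omega>\<^sub>0 + real j * h * B / m" if "j \<le> N" for j
      using that
    proof (induction j)
      case 0
      then show ?case by (simp add: x_def)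
    next
      case (Suc j)
      obtain R \<omega> where x: "x j = (R, \<omega>)" by fastforce
      have "rotation_matrix R"
        using rotation_matrix_filter_iter[of "(R\<^sub>0, \<omega>\<^sub>0)"] R0 x unfolding x_def by (metis fst_conv)
      then have "norm R \<le> 3"
        using norm_orthogonal_matrix_le[of R] by (simp add: rotation_matrix_def)
      then have "norm (F (t\<^sub>0 + real j * h) R) \<le> B"
        using hN[of j] Suc.prems hpos by (intro B(2)) auto
      then have "h * norm (F (t\<^sub>0 + real j * h) R) / m \<le> h * B / m"
        using hpos m by (simp add: divide_right_mono)
      moreover have "norm (snd (x (Suc j))) \<le> norm \<omega> + h * norm (F (t\<^sub>0 + real j * h) R) / m"
        using x norm_velocity_step_le[OF m D hpos] by (simp add: x_def filter_step_split Let_def)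
      ultimately show ?case
        using Suc x by (simp add: algebra_simps add_divide_distrib)
    qed
    moreover have "real i * h * B / m \<le> (T - t\<^sub>0) * B / m"
      using hN[OF N(2)] B(1) m by (intro divide_right_mono mult_right_mono) auto
    ultimately show ?thesis
      using N(2) unfolding x_def by (meson add_left_mono order_trans)
  qed
  then show ?thesis
    by blast
qed

lemma filter_integrator:
  assumes R0: "rotation_matrix R\<^sub>0"
  shows "integrator_of_order 1 \<Psi> f t\<^sub>0 T (R\<^sub>0, \<omega>\<^sub>0)"
  unfolding integrator_of_order_def
proof (intro allI impI)
  fix y assume y: "solves_ode_on f t\<^sub>0 T y" "y t\<^sub>0 = (R\<^sub>0, \<omega>\<^sub>0)"
  have "continuous_on {t\<^sub>0..T} y"
    unfolding continuous_on_eq_continuous_within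
    using y(1) unfolding solves_ode_on_def by (blast intro: has_vector_derivative_continuous)
  then have "bounded (y ` {t\<^sub>0..T})"
    by (intro compact_imp_bounded compact_continuous_image) auto
  then obtain b where b: "\<And>t. t \<in> {t\<^sub>0..T} \<Longrightarrow> norm (y t) \<le> b"
    unfolding bounded_iff by blast
  obtain B where B: "\<And>N i. 1 \<le> N \<Longrightarrow> i \<le> N \<Longrightarrow>
      norm (snd (one_step_iter \<Psi> ((T - t\<^sub>0) / real N) t\<^sub>0 (R\<^sub>0, \<omega>\<^sub>0) i)) \<le> B"
    using filter_iter_bounded[OF R0] by blast
  \<comment> \<open>The radii 3 and \<open>B\<close> accommodate the iterates; \<open>b\<close>,
    from continuity on the compact interval, accommodates the exact solution.\<close>
  define K where "K = cball (0 :: real^3^3) (max 3 b) \<times> cball (0 :: real^3) (max B b)"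
  obtain L where L: "L-lipschitz_on ({t\<^sub>0..T} \<times> K) (\<lambda>(t, x). f t x)"
    using lipschitzian_field unfolding K_def lipschitzian_def by blast
  have "bounded ({t\<^sub>0..T} \<times> K)"
    unfolding K_def by (intro bounded_Times bounded_cball compact_imp_bounded[OF compact_Icc])
  then have "bounded ((\<lambda>(t, x). f t x) ` ({t\<^sub>0..T} \<times> K))"
    using L by (intro lipschitzian_bounded) (auto simp: lipschitzian_def)
  then obtain G where G: "\<And>z. z \<in> {t\<^sub>0..T} \<times> K \<Longrightarrow> norm ((\<lambda>(t, x). f t x) z) \<le> G"
    unfolding bounded_iff by blast
  obtain C where C: "\<And>t h x. t\<^sub>0 \<le> t \<Longrightarrow> 0 < h \<Longrightarrow> t + h \<le> T \<Longrightarrow> x \<in> K \<Longrightarrow>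
      norm (\<Psi> h t x - x - h *\<^sub>R f t x) \<le> C * h\<^sup>2"
    using filter_step_expansion[of "max 3 b" "max B b"] unfolding K_def by blast
  have yK: "y t \<in> K" if "t \<in> {t\<^sub>0..T}" for t
    using b[OF that] norm_fst_le[of "fst (y t)" "snd (y t)"] norm_snd_le[of "snd (y t)" "fst (y t)"]
    by (auto simp: K_def mem_Times_iff le_max_iff_disj)
  have iter: "one_step_iter \<Psi> ((T - t\<^sub>0) / real N) t\<^sub>0 (y t\<^sub>0) i \<in> K" if "1 \<le> N" "i \<le> N" for N i
  proof -
    let ?x = "one_step_iter \<Psi> ((T - t\<^sub>0) / real N) t\<^sub>0 (y t\<^sub>0) i"
    have "rotation_matrix (fst ?x)"
      unfolding y(2) by (rule rotation_matrix_filter_iter) (simp add: R0)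
    then have "norm (fst ?x) \<le> 3"
      using norm_orthogonal_matrix_le[of "fst ?x"] by (simp add: rotation_matrix_def)
    moreover have "norm (snd ?x) \<le> B"
      using B[OF that] unfolding y(2) .
    ultimately show ?thesis
      by (simp add: K_def mem_Times_iff le_max_iff_disj)
  qed
  have bnd: "norm (f t x) \<le> G" if "t \<in> {t\<^sub>0..T}" "x \<in> K" for t x
    using G[of "(t, x)"] that by simp
  show "consistent_of_order 1 \<Psi> t\<^sub>0 T y \<and> convergent_of_order 1 \<Psi> t\<^sub>0 T y"
    using one_step_order_1[where \<Psi> = \<Psi> and f = f and K = K and C = C and y = y and G = G,
        OF less L bnd C y(1) yK iter] by blast
qed

end

text \<open>Lipschitz data in time make the field Lipschitz in time, as the first order estimate
  requires. The initial \<open>\<omega>\<close> is recovered from the estimated angular velocity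
  \<open>\<Omega>\<^sub>0\<close>. The invertibility clause ensures that \<open>matrix_inv\<close>
  in the step is a genuine inverse, and the last clause that the attitude iterates remain in SO(3)
  for every positive step size.\<close>

theorem proposition4p3:
  fixes m t\<^sub>0 T :: real
    and D R\<^sub>0 :: "real^3^3"
    and \<Phi> \<Phi>' :: "real \<Rightarrow> real"
    and E Um :: "real \<Rightarrow> real^'n^3"
    and W :: "real \<Rightarrow> real^'n^'n"
    and \<Omega>m :: "real \<Rightarrow> real^3"
    and \<Omega>\<^sub>0 :: "real^3"
  assumes "t\<^sub>0 < T"
    and "m > 0"
    and "pos_def D"
    and "potential_shape \<Phi> \<Phi>'"
    and "\<And>t. t \<in> {t\<^sub>0..T} \<Longrightarrow> rank (E t) = 3"
    and "\<And>t. t \<in> {t\<^sub>0..T} \<Longrightarrow> admissible_weight (E t) (W t)"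
    and "\<exists>B. B-lipschitz_on {t\<^sub>0..T} E"
    and "\<exists>B. B-lipschitz_on {t\<^sub>0..T} W"
    and "\<exists>B. B-lipschitz_on {t\<^sub>0..T} Um"
    and "\<exists>B. B-lipschitz_on {t\<^sub>0..T} \<Omega>m"
    and "rotation_matrix R\<^sub>0"
  shows "integrator_of_order 1 (filter_step m D \<Phi>' E W Um \<Omega>m) (filter_field m D \<Phi>' E W Um \<Omega>m)
        t\<^sub>0 T (R\<^sub>0, \<Omega>m t\<^sub>0 - \<Omega>\<^sub>0) \<and>
      (\<forall>h>0. invertible (m *\<^sub>R mat 1 + h *\<^sub>R D)) \<and>
      (\<forall>h>0. \<forall>i. rotation_matrix
        (fst (one_step_iter (filter_step m D \<Phi>' E W Um \<Omega>m) h t\<^sub>0 (R\<^sub>0, \<Omega>m t\<^sub>0 - \<Omega>\<^sub>0) i)))"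
proof -
  interpret attitude_filter m t\<^sub>0 T D \<Phi> \<Phi>' E Um W \<Omega>m
  proof
    show "pos_def (W t)" if "t \<in> {t\<^sub>0..T}" for t
      using assms(6)[OF that] unfolding admissible_weight_def by (rule conjunct1)
  qed (simp_all only: assms lipschitzian_def)
  show ?thesis
    using assms(11) shifted_pos_def(2)[OF assms(2,3)]
    by (intro conjI filter_integrator) (simp_all add: rotation_matrix_filter_iter)
qed

end
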